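(* Let $D$ be an infinite division ring, let $N\subseteq D^\times$ be a finite index normal subgroup containing $-1$, and assume that $D^\times/N$ supports a V-graph $\Delta$. Let $\Sigma\le\mathrm{Sym}(D^\times)$ be a permutation group on $D^\times$ such that $\sigma(N)=N$ and $\sigma(xN)=\sigma(x)N$ for all $x\in D^\times$ and $\sigma\in\Sigma$. Assume that $\Delta$ satisfies property $(3\frac12)$ with respect to $x^*,y^*\in\Delta$, the subgroup $\Sigma\le\mathrm{Sym}(D^\times)$, and the subgroup $M\subseteq N$. Then, after perhaps interchanging $x^*$ and $y^*$, the map $\varphi_{y^*}\colon N\to\Gamma_{y^*}$ is a strongly leveled map such that the subgroup $\varphi_{y^*}(M)$ of $\Gamma_{y^*}$ is totally ordered.
   Context: V-graphs. Let $D$ be an infinite division ring and $N$ a proper normal subgroup of finite index in $D^\times$ containing $-1$; for $a\in D^\times$ write $a^*=aN\in D^\times/N$. Consider undirected graphs $\Delta$ whose vertices are the non-identity elements of $D^\times/N$ (one writes $\Delta$ also for the vertex set); $d(\cdot,\cdot)$ is the distance function on vertices, with $d(a^*,b^* )=\infty$ if $a^*,b^*$ lie in different connected components. Such a $\Delta$ is a V-graph associated with $N$ (and $D^\times/N$ supports the V-graph $\Delta$) if for all $a,b,c\in D^\times\setminus N$: (V1) if $a-b\in N$ then $d(a^*,b^* )\le 1$; (V2) if $d(a^*,b^* )\le 1$ then $d((a^{-1})^*,b^* )\le 1$; (V3) if $ab\notin N$ and both $d(a^*,c^* )\le 1$ and $d(a^*b^*,c^* )\le 1$, then $d(b^*,c^*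 )\le 1$. Property $(3\frac12)$. By the assumption on $\Sigma$, each $\sigma\in\Sigma$ induces a permutation of $\Delta$ by $\sigma(x^* )=\sigma(x)^*$. $\Delta$ satisfies Property $(3\frac12)$ with respect to $x^*,y^*\in\Delta$, $\Sigma$ and a subgroup $M\subseteq N$ if $-1\in M$ and: (1) $\sigma(a+k)^*=(\sigma(a)+k)^*$ for every $\sigma\in\Sigma$, $a\in D^\times\setminus N$ and $k\in M$; (2) $d(x^*,y^* )\ge 3$; (3) for every $r^*,s^*\in\Delta$ such that $x^*,r^*,s^*,y^*$ is a path in $\Delta$, there exists $\sigma\in\Sigma$ such that $d(\sigma(x^* ),y^* )\ge 3$ and $\sigma(x)^*,\sigma(r)^*,s^*,y^*$ is not a path in $\Delta$. (A path is a sequence of vertices in which consecutive ones are joined by an edge.) The map $\varphi_{y^*}$. For $y\in D^\times\setminus N$ let $N(y)=\{n\in N\mid y+n\in N\}$. For $m,n\in N$ the condition $N(my)\subseteq N(ny)$ depends only on the coset $y^*$ and defines a reflexive, transitive relation on $N$ invariant under left and right multiplication. $U_{y^*}=\{n\in N\mid N(ny)=N(y)\}$ is a normal subgroup of $N$; $\Gamma_{y^*}=N/U_{y^*}$ (written additively) is a partially ordered group under $mU_{y^*}\le nU_{y^*}\iff N(my)\subseteq N(ny)$; and $\varphi_{y^*}\colon N\to\Gamma_{y^*}$ is the canonical epimorphism. Leveled maps. For a homomorphism $\varphi\colon N\to\Gamma$ to a partially ordered group put $N_{>\alpha}=\{x\in N\mid\varphi(x)>\alpha\}$, similarly $N_{\le\alpha}$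 etc. $\varphi$ is a strongly leveled map if there is $\alpha\ge 0$ in $\Gamma$ with $N_{>\alpha}\neq\emptyset$ and $1\pm N_{>\alpha}\subseteq N_{\le0}$. *)

theory Defs
  imports "HOL-Algebra.Coset" "HOL-Algebra.Bij" "Graph_Theory.Graph_Theory"
begin

definition mult_group :: "'a::division_ring monoid"
  where "mult_group = \<lparr>carrier = UNIV - {0}, monoid.mult = (*), one = 1\<rparr>"

lemma mult_group_simps [simp]:
  "carrier mult_group = UNIV - {0}"
  "x \<otimes>\<^bsub>mult_group\<^esub> y = x * y"
  "\<one>\<^bsub>mult_group\<^esub> = 1"
  by (simp_all add: mult_group_def)

lemma group_mult_group: "group (mult_group :: 'a::division_ring monoid)"
proof (rule groupI)
  fix x :: 'a assume "x \<in> carrier mult_group"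
  then show "\<exists>y\<in>carrier mult_group. y \<otimes>\<^bsub>mult_group\<^esub> x = \<one>\<^bsub>mult_group\<^esub>"
    by (intro bexI[of _ "inverse x"]) auto
qed (auto simp: mult.assoc)

text \<open>The coset \<open>a\<^sup>* = aN\<close>. The carrier of \<open>mult_group Mod N\<close> consists of right
  cosets, which for normal \<open>N\<close> are the same sets.\<close>

definition star :: "'a::division_ring set \<Rightarrow> 'a \<Rightarrow> 'a set"
  where "star N a = a <#\<^bsub>mult_group\<^esub> N"


section \<open>V-graphs\<close>

text \<open>The distance is the least number of edges of a walk, and \<open>\<infinity>\<close> if there is none.\<close>

definition graph_dist :: "'v pair_pre_digraph \<Rightarrow> 'v \<Rightarrow> 'v \<Rightarrow> ereal"
  where "graph_dist \<Delta> = wf_digraph.\<mu> (with_proj \<Delta>) (\<lambda>_. 1)"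

text \<open>The locale \<open>pair_graph\<close> is that of finite simple undirected graphs, an undirected edge
  being a pair of opposite arcs; finiteness is no restriction, as \<open>N\<close> has finite index.\<close>

definition V_graph :: "'a::division_ring set \<Rightarrow> 'a set pair_pre_digraph \<Rightarrow> bool"
  where "V_graph N \<Delta> \<longleftrightarrow>
    N \<noteq> carrier mult_group \<and>
    pair_graph \<Delta> \<and>
    pverts \<Delta> = carrier (mult_group Mod N) - {\<one>\<^bsub>mult_group Mod N\<^esub>} \<and>
    (\<forall>a \<in> carrier mult_group - N. \<forall>b \<in> carrier mult_group - N.
       a - b \<in> N \<longrightarrow> graph_dist \<Delta> (star N a) (star N b) \<le> 1) \<and>
    (\<forall>a \<in> carrier mult_group - N. \<forall>b \<in> carrier mult_group - N.
       graph_dist \<Delta> (star N a) (star N b) \<le> 1 \<longrightarrow>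
       graph_dist \<Delta> (star N (inverse a)) (star N b) \<le> 1) \<and>
    (\<forall>a \<in> carrier mult_group - N. \<forall>b \<in> carrier mult_group - N.
     \<forall>c \<in> carrier mult_group - N.
       a * b \<notin> N \<longrightarrow>
       graph_dist \<Delta> (star N a) (star N c) \<le> 1 \<longrightarrow>
       graph_dist \<Delta> (star N a \<otimes>\<^bsub>mult_group Mod N\<^esub> star N b) (star N c) \<le> 1 \<longrightarrow>
       graph_dist \<Delta> (star N b) (star N c) \<le> 1)"

text \<open>Property $(3\frac12)$. Vertices are given by representatives \<open>x, y, r, s\<close>; the permutation
  induced by \<open>\<sigma>\<close> sends \<open>star N x\<close> to \<open>star N (\<sigma> x)\<close>.\<close>

definition property_3_half ::
  "'a::division_ring set \<Rightarrow> 'a set pair_pre_digraph \<Rightarrow> 'a \<Rightarrow> 'a \<Rightarrow> ('a \<Rightarrow> 'a) set \<Rightarrow> 'a set \<Rightarrow> bool"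
  where "property_3_half N \<Delta> x y \<Sigma> M \<longleftrightarrow>
    - 1 \<in> M \<and>
    (\<forall>\<sigma>\<in>\<Sigma>. \<forall>a \<in> carrier mult_group - N. \<forall>k\<in>M.
       star N (\<sigma> (a + k)) = star N (\<sigma> a + k)) \<and>
    graph_dist \<Delta> (star N x) (star N y) \<ge> 3 \<and>
    (\<forall>r \<in> carrier mult_group - N. \<forall>s \<in> carrier mult_group - N.
       vwalk [star N x, star N r, star N s, star N y] \<Delta> \<longrightarrow>
       (\<exists>\<sigma>\<in>\<Sigma>. graph_dist \<Delta> (star N (\<sigma> x)) (star N y) \<ge> 3 \<and>
          \<not> vwalk [star N (\<sigma> x), star N (\<sigma> r), star N s, star N y] \<Delta>))"


section \<open>Partially ordered groups and leveled maps\<close>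

locale partially_ordered_group = group G for G :: "('g, 'm) monoid_scheme" (structure) +
  fixes r :: "'g rel"
  assumes partial_order: "partial_order_on (carrier G) r"
    and left_mono: "(a, b) \<in> r \<Longrightarrow> c \<in> carrier G \<Longrightarrow> (c \<otimes> a, c \<otimes> b) \<in> r"
    and right_mono: "(a, b) \<in> r \<Longrightarrow> c \<in> carrier G \<Longrightarrow> (a \<otimes> c, b \<otimes> c) \<in> r"

definition level_gt :: "'a set \<Rightarrow> 'g rel \<Rightarrow> ('a \<Rightarrow> 'g) \<Rightarrow> 'g \<Rightarrow> 'a set"
  where "level_gt N r \<phi> \<alpha> = {x \<in> N. (\<alpha>, \<phi> x) \<in> r \<and> \<phi> x \<noteq> \<alpha>}"

definition level_le :: "'a set \<Rightarrow> 'g rel \<Rightarrow> ('a \<Rightarrow> 'g) \<Rightarrow> 'g \<Rightarrow> 'a set"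
  where "level_le N r \<phi> \<alpha> = {x \<in> N. (\<phi> x, \<alpha>) \<in> r}"

text \<open>The group \<open>G\<close>, additive and possibly non-commutative in the usual notation, is written
  multiplicatively here, so its zero is \<open>\<one>\<^bsub>G\<^esub>\<close>.\<close>

definition strongly_leveled_map ::
  "'a::division_ring set \<Rightarrow> ('g, 'm) monoid_scheme \<Rightarrow> 'g rel \<Rightarrow> ('a \<Rightarrow> 'g) \<Rightarrow> bool"
  where "strongly_leveled_map N G r \<phi> \<longleftrightarrow>
    partially_ordered_group G r \<and>
    \<phi> \<in> hom (mult_group\<lparr>carrier := N\<rparr>) G \<and>
    (\<exists>\<alpha>\<in>carrier G. (\<one>\<^bsub>G\<^esub>, \<alpha>) \<in> r \<and>
       level_gt N r \<phi> \<alpha> \<noteq> {} \<and>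
       (\<lambda>x. 1 + x) ` level_gt N r \<phi> \<alpha> \<subseteq> level_le N r \<phi> \<one>\<^bsub>G\<^esub> \<and>
       (\<lambda>x. 1 - x) ` level_gt N r \<phi> \<alpha> \<subseteq> level_le N r \<phi> \<one>\<^bsub>G\<^esub>)"

definition totally_ordered_subgroup :: "'g set \<Rightarrow> ('g, 'm) monoid_scheme \<Rightarrow> 'g rel \<Rightarrow> bool"
  where "totally_ordered_subgroup H G r \<longleftrightarrow>
    subgroup H G \<and> linear_order_on H (r \<inter> H \<times> H)"


section \<open>The map \<open>\<phi>\<close> attached to a coset\<close>

definition N_of :: "'a::division_ring set \<Rightarrow> 'a \<Rightarrow> 'a set"
  where "N_of N y = {n \<in> N. y + n \<in> N}"

definition U_of :: "'a::division_ring set \<Rightarrow> 'a \<Rightarrow> 'a set"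
  where "U_of N y = {n \<in> N. N_of N (n * y) = N_of N y}"

definition Gamma_of :: "'a::division_ring set \<Rightarrow> 'a \<Rightarrow> 'a set monoid"
  where "Gamma_of N y = mult_group\<lparr>carrier := N\<rparr> Mod U_of N y"

definition phi_of :: "'a::division_ring set \<Rightarrow> 'a \<Rightarrow> 'a \<Rightarrow> 'a set"
  where "phi_of N y m = m <#\<^bsub>mult_group\<lparr>carrier := N\<rparr>\<^esub> U_of N y"

definition Gamma_rel :: "'a::division_ring set \<Rightarrow> 'a \<Rightarrow> 'a set rel"
  where "Gamma_rel N y =
    {(phi_of N y m, phi_of N y n) | m n. m \<in> N \<and> n \<in> N \<and> N_of N (m * y) \<subseteq> N_of N (n * y)}"

text \<open>These depend only on the coset of the representative \<open>y\<close>.\<close>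

lemma N_of_mult_right:
  fixes N :: "'a::division_ring set"
  assumes "N \<lhd> mult_group" and "k \<in> N"
  shows "N_of N (y * k) = (\<lambda>n. n * k) ` N_of N y"
proof -
  have sg: "subgroup N mult_group" using assms(1) by (rule normal_imp_subgroup)
  have k0: "k \<noteq> 0" using sg assms(2) subgroup.subset by fastforce
  have cl: "a * b \<in> N" if "a \<in> N" "b \<in> N" for a b
    using subgroup.m_closed[OF sg that] by simp
  have "inv\<^bsub>mult_group\<^esub> k = inverse k"
    by (rule group.inv_equality[OF group_mult_group]) (use k0 in auto)
  then have ik: "inverse k \<in> N"
    using subgroup.m_inv_closed[OF sg assms(2)] by simp
  show ?thesis
  proof (intro Set.set_eqI iffI)
    fix n assume n: "n \<in> N_of N (y * k)"
    have "(y * k + n) * inverse k = y + n * inverse k"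
      using k0 by (simp add: distrib_right mult.assoc)
    then have "n * inverse k \<in> N_of N y"
      using n cl[OF _ ik] unfolding N_of_def by (smt (verit) mem_Collect_eq)
    moreover have "n = n * inverse k * k" using k0 by (simp add: mult.assoc)
    ultimately show "n \<in> (\<lambda>n. n * k) ` N_of N y" by blast
  next
    fix n assume "n \<in> (\<lambda>n. n * k) ` N_of N y"
    then show "n \<in> N_of N (y * k)"
      using cl[OF _ assms(2)] by (auto simp: N_of_def distrib_right[symmetric])
  qed
qed

lemma of_coset:
  fixes N :: "'a::division_ring set"
  assumes N: "N \<lhd> mult_group" and "star N y' = star N y"
  shows "U_of N y' = U_of N y" and "Gamma_of N y' = Gamma_of N y"
    and "phi_of N y' = phi_of N y" and "Gamma_rel N y' = Gamma_rel N y"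
proof -
  have sg: "subgroup N mult_group" using N by (rule normal_imp_subgroup)
  have "1 \<in> N" using subgroup.one_closed[OF sg] by simp
  then have "y' \<in> star N y'" by (force simp: star_def l_coset_def)
  then obtain k where k: "k \<in> N" "y' = y * k"
    unfolding assms(2) by (auto simp: star_def l_coset_def)
  have k0: "k \<noteq> 0" using sg k(1) subgroup.subset by fastforce
  have inj: "inj (\<lambda>n. n * k)" using k0 by (auto intro: injI)
  have eq: "N_of N (m * y') = (\<lambda>n. n * k) ` N_of N (m * y)" for m
    using N_of_mult_right[OF N k(1), of "m * y"] by (simp add: k(2) mult.assoc)
  show U: "U_of N y' = U_of N y"
    using eq eq[of 1] by (auto simp: U_of_def inj_image_eq_iff[OF inj])
  then show "Gamma_of N y' = Gamma_of N y" and phi: "phi_of N y' = phi_of N y"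
    by (auto simp: Gamma_of_def phi_of_def)
  show "Gamma_rel N y' = Gamma_rel N y"
    using inj_image_subset_iff[OF inj] by (simp add: Gamma_rel_def phi eq)
qed

end

theory Submission
  imports Defs "HOL-Library.Ramsey"
begin

text \<open>Call \<open>a, b \<in> D\<^sup>\<times>\<close> perpendicular if one of them lies in \<open>N\<close> or \<open>d(a\<^sup>*, b\<^sup>*) \<le> 1\<close>. The axioms
  of a V-graph say that the elements perpendicular to a fixed one form a group containing \<open>N\<close>, and
  that \<open>a - b \<in> N\<close> makes \<open>a, b\<close> perpendicular; \<open>d(a\<^sup>*, b\<^sup>*) \<ge> 3\<close> says that only \<open>N\<close> is
  perpendicular to both. For such a pair the identities
  \<open>ba - lk = (b + l)a - l(a + k) = b(a + k) - (b + l)k\<close> give \<open>ba - lk \<in> N\<close> whenever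
  \<open>l \<in> N(b)\<close> and \<open>k \<in> N(a)\<close>.

  Applied to \<open>(b, a)\<close> and \<open>(b\<^sup>-\<^sup>1, ba)\<close> this shows that \<open>N(b) \<subseteq> N(a)\<close> as soon as some
  \<open>k \<in> N(a)\<close> has \<open>b + k \<in> bN\<close>. As \<open>N - N = D\<close>, one can interleave translates of \<open>x\<close> and \<open>y\<close>
  in chains, and an \<open>n\<close> far up in such a chain satisfies \<open>n - 1 \<in> N\<close>. Moreover an element
  \<open>1 + b \<in> N\<close> with \<open>b \<in> y\<^sup>*\<close> stabilises each \<open>N(a)\<close>, \<open>a \<in> x\<^sup>*\<close>, hence is bounded for the order
  along \<open>y\<close>; together with \<open>N(-y) = N(y)\<close> this makes \<open>\<phi>\<close> along \<open>y\<close> strongly leveled.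

  If \<open>m \<in> M\<close>, \<open>a + m, b + 1 \<in> N\<close> but \<open>a + 1, b + m \<notin> N\<close>, then \<open>ba - m \<in> N\<close> forces \<open>a + 1\<close> and
  \<open>b + m\<close> to be perpendicular, and Property $(3\frac12)$ allows one to replace \<open>a\<close> by \<open>\<sigma>(a)\<close> to
  exclude this. So the traces on \<open>M\<close> of \<open>N(a)\<close> and \<open>N(b)\<close> are comparable for all \<open>a \<in> x\<^sup>*\<close>,
  \<open>b \<in> y\<^sup>*\<close>, which forces a chain on one of the two sides; since \<open>-1 \<in> M\<close>, that side is also
  invariant under the sign.\<close>

section \<open>Cosets of a normal subgroup\<close>

locale mult_normal =
  fixes N :: "'a::division_ring set"
  assumes normal: "N \<lhd> mult_group" and neg_one: "- 1 \<in> N"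
begin

lemma subgroup: "subgroup N mult_group"
  using normal by (rule normal_imp_subgroup)

lemma inv_mult_group: "a \<noteq> 0 \<Longrightarrow> inv\<^bsub>mult_group\<^esub> a = inverse a" for a :: 'a
  by (rule group.inv_equality[OF group_mult_group]) auto

lemma zero_notin: "0 \<notin> N"
  using subgroup.subset[OF subgroup] by auto

lemma nonzero: "n \<in> N \<Longrightarrow> n \<noteq> 0"
  using zero_notin by auto

lemma one_in: "1 \<in> N"
  using subgroup.one_closed[OF subgroup] by simp

lemma mult_in: "m \<in> N \<Longrightarrow> n \<in> N \<Longrightarrow> m * n \<in> N"
  using subgroup.m_closed[OF subgroup] by force

lemma inverse_in: "n \<in> N \<Longrightarrow> inverse n \<in> N"
  using subgroup.m_inv_closed[OF subgroup, of n] inv_mult_group[OF nonzero] by simp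

lemma inverse_in_iff: "inverse n \<in> N \<longleftrightarrow> n \<in> N"
  using inverse_in[of n] inverse_in[of "inverse n"] by auto

lemma minus_in_iff: "- n \<in> N \<longleftrightarrow> n \<in> N"
  using mult_in[OF neg_one, of n] mult_in[OF neg_one, of "- n"] by auto

lemma add_nonzero: "a \<notin> N \<Longrightarrow> k \<in> N \<Longrightarrow> a + k \<noteq> 0"
  by (metis eq_neg_iff_add_eq_0 minus_in_iff)

lemma mult_left_iff: "m \<in> N \<Longrightarrow> m * a \<in> N \<longleftrightarrow> a \<in> N"
  using mult_in[of m a] mult_in[OF inverse_in, of m "m * a"] nonzero[of m]
  by (auto simp: mult.assoc[symmetric])

lemma mult_right_iff: "m \<in> N \<Longrightarrow> a * m \<in> N \<longleftrightarrow> a \<in> N"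
  using mult_in[of a m] mult_in[OF _ inverse_in, of "a * m" m] nonzero[of m]
  by (auto simp: mult.assoc)

lemma conj_in: "a \<noteq> 0 \<Longrightarrow> n \<in> N \<Longrightarrow> a * n * inverse a \<in> N"
  using group.normal_invE(2)[OF group_mult_group normal, of a n]
  by (simp add: inv_mult_group nonzero)

lemma conj_in': "a \<noteq> 0 \<Longrightarrow> n \<in> N \<Longrightarrow> inverse a * n * a \<in> N"
  using conj_in[of "inverse a" n] by simp

lemma star_eq: "star N a = {a * n | n. n \<in> N}"
  by (auto simp: star_def l_coset_def)

lemma star_self: "a \<in> star N a"
  using one_in by (force simp: star_eq)

lemma star_eq_iff: "star N a = star N b \<longleftrightarrow> (\<exists>n\<in>N. b = a * n)"
proof
  assume "star N a = star N b"
  then have "b \<in> star N a" using star_self by metis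
  then show "\<exists>n\<in>N. b = a * n" by (auto simp: star_eq)
next
  assume "\<exists>n\<in>N. b = a * n"
  then obtain n where n: "n \<in> N" "b = a * n" by auto
  have "a * k = b * (inverse n * k)" for k
    using n nonzero[OF n(1)] by (metis mult.assoc mult.right_neutral right_inverse)
  then show "star N a = star N b"
    using n mult_in inverse_in by (auto simp: star_eq mult.assoc) blast+
qed

lemma star_mult_right: "n \<in> N \<Longrightarrow> star N (a * n) = star N a"
  by (metis star_eq_iff)

lemma star_mult_left: "n \<in> N \<Longrightarrow> star N (n * a) = star N a"
proof (cases "a = 0")
  case False
  assume n: "n \<in> N"
  have "n * a = a * (inverse a * n * a)" using False by (simp add: mult.assoc[symmetric])
  then show ?thesis using star_mult_right[OF conj_in'[OF False n]] by metis
qed simp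

lemma star_memD:
  assumes "b \<in> star N a" and "n \<in> N"
  shows "b * n \<in> star N a" and "n * b \<in> star N a"
proof -
  have "star N b = star N a" using assms(1) star_mult_right by (auto simp: star_eq[of a])
  then show "b * n \<in> star N a" "n * b \<in> star N a"
    using star_mult_right[OF assms(2), of b] star_mult_left[OF assms(2), of b] star_self by metis+
qed

lemma N_of_iff: "n \<in> N_of N y \<longleftrightarrow> n \<in> N \<and> y + n \<in> N"
  by (simp add: N_of_def)

lemma N_of_mult_left_iff: "k \<in> N \<Longrightarrow> k * n \<in> N_of N (k * y) \<longleftrightarrow> n \<in> N_of N y"
  by (simp add: N_of_iff mult_left_iff flip: distrib_left)

lemma N_of_mult_right_iff: "k \<in> N \<Longrightarrow> n * k \<in> N_of N (y * k) \<longleftrightarrow> n \<in> N_of N y"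
  by (simp add: N_of_iff mult_right_iff flip: distrib_right)

lemma N_of_mult_left_iff': "k \<in> N \<Longrightarrow> n \<in> N_of N (k * y) \<longleftrightarrow> inverse k * n \<in> N_of N y"
  using N_of_mult_left_iff[of k "inverse k * n" y] nonzero[of k]
  by (simp add: mult.assoc[symmetric])

lemma N_of_mult_right_iff': "k \<in> N \<Longrightarrow> n \<in> N_of N (y * k) \<longleftrightarrow> n * inverse k \<in> N_of N y"
  using N_of_mult_right_iff[of k "n * inverse k" y] nonzero[of k]
  by (simp add: mult.assoc)

lemma N_of_mult_left_image: "k \<in> N \<Longrightarrow> N_of N (k * y) = (*) k ` N_of N y"
proof (intro Set.set_eqI iffI)
  fix n assume k: "k \<in> N" and "n \<in> N_of N (k * y)"
  then have "n = k * (inverse k * n)" "inverse k * n \<in> N_of N y"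
    using nonzero[OF k] by (auto simp: N_of_mult_left_iff' mult.assoc[symmetric])
  then show "n \<in> (*) k ` N_of N y" by blast
qed (auto simp: N_of_mult_left_iff)

lemma N_of_uminus_mult:
  "N_of N (- y) = N_of N y \<Longrightarrow> n \<in> N \<Longrightarrow> N_of N (- n * y) = N_of N (n * y)"
  using N_of_mult_left_image[of n "- y"] N_of_mult_left_image[of n y] by simp

lemma N_of_mult_left_subset_iff:
  assumes "k \<in> N"
  shows "N_of N (k * a) \<subseteq> N_of N (k * b) \<longleftrightarrow> N_of N a \<subseteq> N_of N b"
proof -
  have "inj ((*) k)" using nonzero[OF assms] by (auto intro: injI)
  then show ?thesis by (simp add: N_of_mult_left_image[OF assms] inj_image_subset_iff)
qed

lemma N_of_mult_right_subset_iff: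
  assumes "k \<in> N"
  shows "N_of N (a * k) \<subseteq> N_of N (b * k) \<longleftrightarrow> N_of N a \<subseteq> N_of N b"
proof -
  have "inj (\<lambda>n. n * k)" using nonzero[OF assms] by (auto intro: injI)
  then show ?thesis by (simp add: N_of_mult_right[OF normal assms] inj_image_subset_iff)
qed

text \<open>Rests on \<open>inverse b * (b + l) = (inverse b + inverse l) * l\<close>. It expresses
  \<open>b + l \<in> bN\<close>, the situation opposite to \<open>l \<in> N(b)\<close>, in terms of
  the sets \<open>N_of\<close> alone.\<close>

lemma inverse_in_N_of_inverse_iff:
  assumes "b \<noteq> 0" and "l \<in> N"
  shows "inverse l \<in> N_of N (inverse b) \<longleftrightarrow> inverse b * (b + l) \<in> N"
proof -
  have "inverse b * (b + l) = (inverse b + inverse l) * l"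
    using assms nonzero by (simp add: distrib_left distrib_right mult.assoc add.commute)
  then show ?thesis using assms by (simp add: N_of_iff inverse_in mult_right_iff)
qed

lemma N_of_inverse_disjoint:
  assumes "b \<noteq> 0" and "b \<notin> N" and "l \<in> N_of N b" shows "inverse l \<notin> N_of N (inverse b)"
proof -
  have "b + l \<in> N" "l \<in> N" using assms by (auto simp: N_of_iff)
  then have "inverse b * (b + l) \<notin> N" using assms(2) by (simp add: mult_right_iff inverse_in_iff)
  then show ?thesis using inverse_in_N_of_inverse_iff[OF assms(1) \<open>l \<in> N\<close>] by blast
qed

end

section \<open>Perpendicularity\<close>

text \<open>The axioms without the graph: (V3) becomes closure under products, and
  \<open>N_of_nonempty\<close> is the form in which \<open>N - N = D\<close> enters.\<close>

locale perp_relation = mult_normal N for N :: "'a::division_ring set" +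
  fixes perp :: "'a \<Rightarrow> 'a \<Rightarrow> bool"
  assumes perp_nonzero: "perp a b \<Longrightarrow> a \<noteq> 0"
    and perp_sym: "perp a b \<Longrightarrow> perp b a"
    and perp_refl: "a \<noteq> 0 \<Longrightarrow> perp a a"
    and perp_N: "n \<in> N \<Longrightarrow> b \<noteq> 0 \<Longrightarrow> perp n b"
    and perp_mult: "perp a c \<Longrightarrow> perp b c \<Longrightarrow> perp (a * b) c"
    and perp_inverse: "perp a c \<Longrightarrow> perp (inverse a) c"
    and perp_diff: "a - b \<in> N \<Longrightarrow> a \<noteq> 0 \<Longrightarrow> b \<noteq> 0 \<Longrightarrow> perp a b"
    and N_of_nonempty: "a \<noteq> 0 \<Longrightarrow> N_of N a \<noteq> {}"
begin

text \<open>For non-trivial cosets this is \<open>d(a\<^sup>*, b\<^sup>*) \<ge> 3\<close>.\<close>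

definition far :: "'a \<Rightarrow> 'a \<Rightarrow> bool"
  where "far a b \<longleftrightarrow> a \<notin> N \<and> b \<notin> N \<and> a \<noteq> 0 \<and> b \<noteq> 0 \<and> (\<forall>c. perp c a \<longrightarrow> perp c b \<longrightarrow> c \<in> N)"

lemma perp_nonzero2: "perp a b \<Longrightarrow> b \<noteq> 0"
  using perp_sym perp_nonzero by blast

lemma perp_mult_left_cancel: "perp (a * b) c \<Longrightarrow> perp a c \<Longrightarrow> perp b c"
  using perp_mult[OF perp_inverse, of a c "a * b"] perp_nonzero[of a c]
  by (simp add: mult.assoc[symmetric])

lemma perp_mult_right_cancel: "perp (a * b) c \<Longrightarrow> perp b c \<Longrightarrow> perp a c"
  using perp_mult[OF _ perp_inverse, of "a * b" c b] perp_nonzero[of b c]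
  by (simp add: mult.assoc)

lemma perp_mult2_left_cancel: "perp c (a * b) \<Longrightarrow> perp c a \<Longrightarrow> perp c b"
  using perp_mult_left_cancel perp_sym by blast

lemma perp_mult2_right_cancel: "perp c (a * b) \<Longrightarrow> perp c b \<Longrightarrow> perp c a"
  using perp_mult_right_cancel perp_sym by blast

lemma perp_N2: "n \<in> N \<Longrightarrow> b \<noteq> 0 \<Longrightarrow> perp b n"
  using perp_N perp_sym by blast

lemma farD: "far a b \<Longrightarrow> perp c a \<Longrightarrow> perp c b \<Longrightarrow> c \<in> N"
  by (auto simp: far_def)

lemma far_nonzero: "far a b \<Longrightarrow> a \<noteq> 0" "far a b \<Longrightarrow> b \<noteq> 0"
  and far_notin: "far a b \<Longrightarrow> a \<notin> N" "far a b \<Longrightarrow> b \<notin> N"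
  by (auto simp: far_def)

lemma far_sym: "far a b \<Longrightarrow> far b a"
  by (auto simp: far_def)

lemma far_mult_right:
  assumes "far a b" and k: "k \<in> N" shows "far (a * k) b"
proof -
  have "perp c a" if "perp c (a * k)" for c
    using perp_mult2_right_cancel[OF that perp_N2[OF k perp_nonzero[OF that]]] .
  then show ?thesis using assms nonzero[OF k] unfolding far_def by (auto simp: mult_right_iff)
qed

lemma far_mult_left:
  assumes "far a b" and k: "k \<in> N" shows "far (k * a) b"
proof -
  have "perp c a" if "perp c (k * a)" for c
    using perp_mult2_left_cancel[OF that perp_N2[OF k perp_nonzero[OF that]]] .
  then show ?thesis using assms nonzero[OF k] unfolding far_def by (auto simp: mult_left_iff)
qed

lemma far_inverse: "far a b \<Longrightarrow> far (inverse a) b"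
  unfolding far_def
  using perp_sym perp_inverse by (metis inverse_in_iff inverse_inverse_eq inverse_zero_imp_zero)

lemma far_inverse_inverse: "far a b \<Longrightarrow> far (inverse b) (inverse a)"
  using far_inverse far_sym by blast

text \<open>Whatever is perpendicular to \<open>b\<close> and \<open>ba\<close> is perpendicular to
  \<open>b\<close> and \<open>a\<close>; if \<open>ba\<close> were in \<open>N\<close>, then
  \<open>b\<close> itself would be such an element. This permits a second use of the product rule,
  on a pair whose product is \<open>a\<close>.\<close>

lemma far_inverse_mult:
  assumes "far b a" shows "far (inverse b) (b * a)"
proof -
  have b: "b \<noteq> 0" "a \<noteq> 0" "b \<notin> N" "a \<notin> N" using assms by (auto simp: far_def)
  have perp_b: "perp c b" if "perp c (inverse b)" for c
    using perp_sym[OF perp_inverse[OF perp_sym[OF that]]] b by simp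
  have "c \<in> N" if "perp c (inverse b)" "perp c (b * a)" for c
    using farD[OF assms perp_b] perp_mult2_left_cancel perp_b that by blast
  moreover have "b * a \<notin> N"
  proof
    assume "b * a \<in> N"
    then have "perp b (b * a)" using b by (intro perp_N2) auto
    then have "perp b a" using perp_mult2_left_cancel perp_refl b by blast
    then show False using farD[OF assms] perp_refl b by blast
  qed
  ultimately show ?thesis using b by (auto simp: far_def inverse_in_iff)
qed

lemma far_mult_notin: "far b a \<Longrightarrow> b * a \<notin> N"
  using far_inverse_mult far_notin(2) by blast

text \<open>The element differs from \<open>(b + l)a\<close> and from \<open>b(a + k)\<close> by
  elements of \<open>N\<close>, so it is perpendicular to both \<open>a\<close> and
  \<open>b\<close>.\<close>

lemma N_of_mult:
  assumes far: "far b a" and l: "l \<in> N_of N b" and k: "k \<in> N_of N a"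
  shows "b * a - l * k \<in> N"
proof -
  let ?w = "b * a - l * k"
  have nz: "a \<noteq> 0" "b \<noteq> 0" using far by (auto simp: far_def)
  have w0: "?w \<noteq> 0" using far_mult_notin[OF far] mult_in l k by (auto simp: N_of_iff)
  have "?w - (b + l) * a = - (l * (a + k))" by (simp add: algebra_simps)
  then have "perp ?w ((b + l) * a)"
    using l k nz w0 nonzero[of "b + l"] by (intro perp_diff) (auto simp: N_of_iff minus_in_iff mult_in)
  then have 1: "perp ?w a"
    using perp_mult2_left_cancel perp_N2[OF _ w0, of "b + l"] l by (auto simp: N_of_iff)
  have "?w - b * (a + k) = - ((b + l) * k)" by (simp add: algebra_simps)
  then have "perp ?w (b * (a + k))"
    using l k nz w0 nonzero[of "a + k"] by (intro perp_diff) (auto simp: N_of_iff minus_in_iff mult_in)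
  then have 2: "perp ?w b"
    using perp_mult2_right_cancel perp_N2[OF _ w0, of "a + k"] k by (auto simp: N_of_iff)
  show ?thesis using farD[OF far] 1 2 by blast
qed

text \<open>The hypotheses on \<open>k\<close> say \<open>a + k \<in> N\<close> and \<open>b + k \<in> bN\<close>; in valuation terms \<open>k\<close> lies
  strictly between \<open>b\<close> and \<open>a\<close>. After scaling to \<open>k = 1\<close>, apply the product rule first to
  \<open>(b, a)\<close> and then to \<open>(b\<^sup>-\<^sup>1, ba)\<close>.\<close>

lemma N_of_subset:
  assumes far: "far a b" and k: "k \<in> N_of N a" and k': "inverse k \<in> N_of N (inverse b)"
  shows "N_of N b \<subseteq> N_of N a"
proof
  fix l assume l: "l \<in> N_of N b"
  have kN: "k \<in> N" and ki: "inverse k \<in> N" using k by (auto simp: N_of_iff inverse_in_iff)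
  define a1 b1 where "a1 = a * inverse k" and "b1 = b * inverse k"
  have far1: "far b1 a1"
    unfolding a1_def b1_def using far far_sym far_mult_right ki by blast
  have 1: "1 \<in> N_of N a1"
    using N_of_mult_right_iff[OF ki, of k a] k nonzero[OF kN] by (simp add: a1_def)
  have 2: "1 \<in> N_of N (inverse b1)"
    using N_of_mult_left_iff[OF kN, of "inverse k" "inverse b"] k' nonzero[OF kN] far_nonzero[OF far]
    by (simp add: b1_def nonzero_inverse_mult_distrib)
  have 3: "l * inverse k \<in> N_of N b1"
    using N_of_mult_right_iff[OF ki] l by (simp add: b1_def)
  have "b1 * a1 - l * inverse k \<in> N" using N_of_mult[OF far1 3 1] by simp
  then have "- (l * inverse k) \<in> N_of N (b1 * a1)" using 3 by (simp add: N_of_iff minus_in_iff)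
  \<comment> \<open>The product is now \<open>inverse b1 * (b1 * a1) = a1\<close>, and the two minus
    signs cancel, which gives \<open>a1 + l * inverse k \<in> N\<close>.\<close>
  from N_of_mult[OF far_inverse_mult[OF far1] 2 this]
  have "l * inverse k \<in> N_of N a1"
    using 3 far_nonzero[OF far1] by (simp add: N_of_iff mult.assoc[symmetric])
  then show "l \<in> N_of N a" using N_of_mult_right_iff[OF ki] by (simp add: a1_def)
qed

text \<open>The hypotheses of \<open>N_of_subset\<close> are invariant under replacing
  \<open>a\<close>, \<open>b\<close>, \<open>k\<close> by \<open>inverse b\<close>,
  \<open>inverse a\<close>, \<open>inverse k\<close>.\<close>

lemma N_of_inverse_subset:
  assumes "far a b" and "k \<in> N_of N a" and "inverse k \<in> N_of N (inverse b)"
  shows "N_of N (inverse a) \<subseteq> N_of N (inverse b)"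
  using N_of_subset[OF far_inverse_inverse[OF assms(1)] assms(3)] assms(2) by simp

text \<open>Here \<open>l - k = (a + l) - (a + k)\<close> with \<open>a + k \<in> N\<close> and
  \<open>a + l \<in> aN\<close>, so the difference is perpendicular to \<open>aN\<close>. It is
  nonzero because no element satisfies both conditions.\<close>

lemma diff_perp:
  assumes "a \<noteq> 0" and "a \<notin> N" and "k \<in> N_of N a" and "inverse l \<in> N_of N (inverse a)"
  shows "perp (l - k) a"
proof -
  have lN: "l \<in> N" using assms(4) by (auto simp: N_of_iff inverse_in_iff)
  have i: "inverse a * (a + l) \<in> N" using assms inverse_in_N_of_inverse_iff lN by blast
  have eq: "a + l = a * (inverse a * (a + l))" using assms by (simp add: mult.assoc[symmetric])
  have nz: "a + l \<noteq> 0" using i zero_notin by auto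
  have "l \<noteq> k" using N_of_inverse_disjoint assms by blast
  then have "l - k \<noteq> 0" by simp
  moreover have "(l - k) - (a + l) = - (a + k)" by simp
  then have "(l - k) - (a + l) \<in> N" using assms(3) by (metis N_of_iff minus_in_iff)
  ultimately have "perp (l - k) (a + l)" using nz by (intro perp_diff)
  then have "perp (l - k) (a * (inverse a * (a + l)))" using eq by simp
  then show ?thesis using perp_mult2_right_cancel perp_N2[OF i perp_nonzero] by blast
qed

lemma diff_in:
  assumes "far a b" and "k \<in> N_of N a" and "k \<in> N_of N b"
    and "inverse l \<in> N_of N (inverse a)" and "inverse l \<in> N_of N (inverse b)"
  shows "l - k \<in> N"
  using farD[OF assms(1)] diff_perp assms far_nonzero far_notin by metis

text \<open>The sum \<open>a + (1 + b)k\<close> differs from \<open>a\<close> by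
  \<open>(1 + b)k\<close> and from \<open>bk\<close> by \<open>a + k\<close>, both in
  \<open>N\<close>. Hence it is perpendicular to \<open>a\<close> and \<open>b\<close>.\<close>

lemma one_plus_stabilizes:
  assumes far: "far a b" and c: "1 + b \<in> N" and k: "k \<in> N_of N a"
  shows "(1 + b) * k \<in> N_of N a"
proof -
  have kN: "k \<in> N" and ki: "inverse k \<in> N" using k by (auto simp: N_of_iff inverse_in_iff)
  define r where "r = a + (1 + b) * k"
  have r: "r - b * k \<in> N" using k by (simp add: r_def N_of_iff algebra_simps)
  have nz: "a \<noteq> 0" "b \<noteq> 0" using far by (auto simp: far_def)
  have "r \<in> N"
  proof (rule farD[OF far])
    have r0: "r \<noteq> 0"
    proof
      assume "r = 0"
      then have "a = - ((1 + b) * k)" by (simp add: r_def eq_neg_iff_add_eq_0)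
      then show False using far_notin[OF far] mult_in[OF c kN] by (simp add: minus_in_iff)
    qed
    show "perp r a"
      using mult_in[OF c kN] nz r0 by (intro perp_diff) (auto simp: r_def)
    have "perp r (b * k)" using r r0 nz nonzero[OF kN] by (intro perp_diff) auto
    then show "perp r b" using perp_mult2_right_cancel perp_N2[OF kN r0] by blast
  qed
  then show ?thesis using mult_in[OF c kN] by (simp add: N_of_iff r_def)
qed

text \<open>A translate \<open>a\<close> of \<open>x\<close> is placed above \<open>y\<close>, and a
  translate of \<open>y\<close> strictly above \<open>a\<close>. Two elements on opposite sides of
  both \<open>a\<close> and \<open>y\<close> then differ by an element of \<open>N\<close>, by
  \<open>diff_in\<close>.\<close>

lemma level_exists:
  assumes far: "far x y"
  obtains \<alpha> a where "\<alpha> \<in> N" and "a \<in> star N x" and "N_of N y \<subseteq> N_of N a"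
    and "N_of N a \<subset> N_of N (\<alpha> * y)"
    and "\<And>n. n \<in> N \<Longrightarrow> N_of N (\<alpha> * y) \<subseteq> N_of N (n * y) \<Longrightarrow> n - 1 \<in> N"
proof -
  have nz: "x \<noteq> 0" "y \<noteq> 0" using far by (auto simp: far_def)
  obtain k where k: "k \<in> N_of N x" using N_of_nonempty nz by blast
  obtain \<rho> where \<rho>: "\<rho> \<in> N_of N (inverse y)" using N_of_nonempty nz by fastforce
  have kN: "k \<in> N" and \<rho>N: "\<rho> \<in> N" using k \<rho> by (auto simp: N_of_iff)
  \<comment> \<open>This scaling carries \<open>k \<in> N(x)\<close> to
    \<open>inverse \<rho>\<close>, which then separates \<open>a\<close> from \<open>y\<close> as
    \<open>N_of_subset\<close> requires.\<close>
  define a where "a = x * inverse k * inverse \<rho>"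
  have cN: "inverse k * inverse \<rho> \<in> N" using kN \<rho>N by (simp add: mult_in inverse_in)
  have a_star: "a \<in> star N x" using star_memD(1)[OF star_self cN] by (simp add: a_def mult.assoc)
  have fara: "far a y" using far_mult_right[OF far cN] by (simp add: a_def mult.assoc)
  have \<rho>a: "inverse \<rho> \<in> N_of N a"
    using N_of_mult_right_iff[OF cN, of k x] k nonzero[OF kN]
    by (simp add: a_def mult.assoc[symmetric])
  have \<rho>': "inverse (inverse \<rho>) \<in> N_of N (inverse y)" using \<rho> by simp
  have s1: "N_of N y \<subseteq> N_of N a" "N_of N (inverse a) \<subseteq> N_of N (inverse y)"
    using N_of_subset[OF fara \<rho>a \<rho>'] N_of_inverse_subset[OF fara \<rho>a \<rho>'] by auto
  obtain \<mu> where \<mu>: "\<mu> \<in> N_of N (inverse a)" using N_of_nonempty far_nonzero[OF fara] by fastforce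
  obtain l where l: "l \<in> N_of N y" using N_of_nonempty nz by blast
  have \<mu>N: "\<mu> \<in> N" and lN: "l \<in> N" using \<mu> l by (auto simp: N_of_iff)
  \<comment> \<open>Chosen so that \<open>\<alpha> * l = inverse \<mu>\<close>: this element
    separates \<open>\<alpha> * y\<close> from \<open>a\<close>.\<close>
  define \<alpha> where "\<alpha> = inverse \<mu> * inverse l"
  have \<alpha>N: "\<alpha> \<in> N" using \<mu>N lN by (simp add: \<alpha>_def mult_in inverse_in)
  have \<mu>\<alpha>: "inverse \<mu> \<in> N_of N (\<alpha> * y)"
    using N_of_mult_left_iff[OF \<alpha>N, of l y] l nonzero[OF lN] by (simp add: \<alpha>_def mult.assoc)
  have "N_of N a \<subseteq> N_of N (\<alpha> * y)"
    using N_of_subset[OF far_mult_left[OF far_sym[OF fara] \<alpha>N] \<mu>\<alpha>] \<mu> by simp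
  moreover have "inverse \<mu> \<notin> N_of N a"
    using N_of_inverse_disjoint[of a "inverse \<mu>"] far_notin[OF fara] far_nonzero[OF fara] \<mu> by auto
  ultimately have s2: "N_of N a \<subset> N_of N (\<alpha> * y)" using \<mu>\<alpha> by blast
  have "n - 1 \<in> N" if n: "n \<in> N" and sub: "N_of N (\<alpha> * y) \<subseteq> N_of N (n * y)" for n
  proof -
    have 1: "inverse n * inverse \<mu> \<in> N_of N y" using \<mu>\<alpha> sub N_of_mult_left_iff'[OF n] by blast
    have "inverse \<mu> - inverse n * inverse \<mu> \<in> N"
      using diff_in[OF fara _ 1, of "inverse \<mu>"] 1 s1 \<mu> by auto
    moreover have "inverse \<mu> - inverse n * inverse \<mu> = inverse n * (n - 1) * inverse \<mu>"
      using nonzero[OF n] by (simp add: left_diff_distrib right_diff_distrib)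
    ultimately show ?thesis
      using n \<mu>N by (simp add: mult_left_iff mult_right_iff inverse_in)
  qed
  with \<alpha>N a_star s1(1) s2 show thesis using that by blast
qed

lemma far_star_left: "far x y \<Longrightarrow> a \<in> star N x \<Longrightarrow> far a y"
  using far_mult_right by (auto simp: star_eq)

text \<open>Sign invariance turns \<open>n - 1\<close> in \<open>level_exists\<close> into
  \<open>1 + n\<close>. For the bound on \<open>1 + n\<close>, the identity
  \<open>(1 + n)(y + k) = (c + n)k\<close> reduces \<open>y + k \<in> N\<close> to
  \<open>1 + inverse c * n \<in> N\<close>, so it suffices that \<open>inverse c * n\<close> still
  lies above \<open>\<beta>\<close>.\<close>

lemma strong_level:
  assumes far: "far x y" and sym: "N_of N (- y) = N_of N y"
  obtains \<alpha> where "\<alpha> \<in> N" and "N_of N y \<subseteq> N_of N (\<alpha> * y)"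
    and "\<exists>n\<in>N. N_of N (\<alpha> * y) \<subset> N_of N (n * y)"
    and "\<And>n. n \<in> N \<Longrightarrow> N_of N (\<alpha> * y) \<subseteq> N_of N (n * y) \<Longrightarrow>
           1 + n \<in> N \<and> N_of N ((1 + n) * y) \<subseteq> N_of N y"
proof -
  obtain \<beta> a where \<beta>: "\<beta> \<in> N" and a: "a \<in> star N x" and ya: "N_of N y \<subseteq> N_of N a"
    and ab: "N_of N a \<subset> N_of N (\<beta> * y)"
    and lev: "\<And>n. n \<in> N \<Longrightarrow> N_of N (\<beta> * y) \<subseteq> N_of N (n * y) \<Longrightarrow> n - 1 \<in> N"
    by (rule level_exists[OF far]) (rule that)
  note neg = N_of_uminus_mult[OF sym]
  have lev': "1 + n \<in> N" if n: "n \<in> N" and "N_of N (\<beta> * y) \<subseteq> N_of N (n * y)" for n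
    using lev[of "- n"] that neg[OF n] minus_in_iff[of "- n - 1"] by (simp add: minus_in_iff add.commute)
  \<comment> \<open>The second factor \<open>\<beta>\<close> makes room for a translate of \<open>N_of N a\<close>, which does not move
    under multiplication by \<open>c = 1 + b\<close> below.\<close>
  define \<alpha> where "\<alpha> = \<beta> * \<beta>"
  have \<alpha>: "\<alpha> \<in> N" using \<beta> by (simp add: \<alpha>_def mult_in)
  have sub\<beta>: "N_of N (\<beta> * (c * y)) \<subseteq> N_of N (\<beta> * (d * y))" if "N_of N (c * y) \<subseteq> N_of N (d * y)" for c d
    using that N_of_mult_left_subset_iff[OF \<beta>] by blast
  have 1: "N_of N y \<subset> N_of N (\<beta> * y)" using ya ab by blast
  have 2: "N_of N (\<beta> * y) \<subset> N_of N (\<alpha> * y)"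
    using 1 N_of_mult_left_subset_iff[OF \<beta>, of y "\<beta> * y"]
      N_of_mult_left_subset_iff[OF \<beta>, of "\<beta> * y" y] by (simp add: \<alpha>_def mult.assoc) blast
  have 3: "N_of N (\<alpha> * y) \<subset> N_of N (\<beta> * \<alpha> * y)"
    using 2 N_of_mult_left_subset_iff[OF \<beta>, of "\<beta> * y" "\<alpha> * y"]
      N_of_mult_left_subset_iff[OF \<beta>, of "\<alpha> * y" "\<beta> * y"] by (simp add: \<alpha>_def mult.assoc) blast
  have "1 + n \<in> N \<and> N_of N ((1 + n) * y) \<subseteq> N_of N y"
    if n: "n \<in> N" and sub: "N_of N (\<alpha> * y) \<subseteq> N_of N (n * y)" for n
  proof
    show m: "1 + n \<in> N" using lev'[OF n] sub 2 by blast
    show "N_of N ((1 + n) * y) \<subseteq> N_of N y"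
    proof
      fix k assume k: "k \<in> N_of N ((1 + n) * y)"
      have kN: "k \<in> N" and ki: "inverse k \<in> N" using k by (auto simp: N_of_iff inverse_in)
      define b where "b = (1 + n) * y * inverse k"
      define c where "c = 1 + b"
      have "c = ((1 + n) * y + k) * inverse k"
        using nonzero[OF kN] by (simp add: c_def b_def distrib_right)
      then have c: "c \<in> N" using k ki by (simp add: N_of_iff mult_in)
      have "b = (1 + n) * (y * inverse k)" by (simp add: b_def mult.assoc)
      then have "far b x"
        using far_mult_left[OF far_mult_right[OF far_sym[OF far] ki] m] by simp
      then have farb: "far (\<beta> * a) b"
        using far_star_left[OF far_sym] a far_mult_left[OF _ \<beta>] by blast
      have ci: "inverse c * n \<in> N" using c n by (simp add: mult_in inverse_in)
      \<comment> \<open>Multiplication by \<open>c\<close> maps \<open>N(\<beta>a)\<close> into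
        itself, and this set lies between \<open>N(\<beta>y)\<close> and
        \<open>N(\<alpha>y)\<close>; so dividing \<open>n\<close> by \<open>c\<close> costs at most
        one factor \<open>\<beta>\<close>.\<close>
      have "N_of N (\<beta> * y) \<subseteq> N_of N (inverse c * n * y)"
      proof
        fix g assume g: "g \<in> N_of N (\<beta> * y)"
        have "N_of N (\<beta> * y) \<subseteq> N_of N (\<beta> * a)" "N_of N (\<beta> * a) \<subseteq> N_of N (\<alpha> * y)"
          using ya ab N_of_mult_left_subset_iff[OF \<beta>] by (auto simp: \<alpha>_def mult.assoc)
        then have "c * g \<in> N_of N (n * y)"
          using one_plus_stabilizes[OF farb, of g] g c sub by (auto simp: c_def)
        then show "g \<in> N_of N (inverse c * n * y)"
          using N_of_mult_left_iff[OF inverse_in[OF c], of "c * g" "n * y"] nonzero[OF c]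
          by (simp add: mult.assoc[symmetric])
      qed
      then have "1 + inverse c * n \<in> N" using lev' ci by blast
      then have cn: "c + n \<in> N"
        using mult_in[OF c, of "1 + inverse c * n"] nonzero[OF c]
        by (simp add: distrib_left mult.assoc[symmetric])
      have "(1 + n) * (y + k) = (c + n) * k"
        using nonzero[OF kN] by (simp add: c_def b_def distrib_left distrib_right mult.assoc)
      then have "y + k \<in> N" using mult_left_iff[OF m] mult_in[OF cn kN] by metis
      then show "k \<in> N_of N y" using kN by (simp add: N_of_iff)
    qed
  qed
  moreover have "N_of N y \<subseteq> N_of N (\<alpha> * y)" using 1 2 by blast
  moreover have "\<exists>n\<in>N. N_of N (\<alpha> * y) \<subset> N_of N (n * y)" using 3 \<alpha> \<beta> mult_in by blast
  ultimately show thesis using that \<alpha> by blast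
qed

end

section \<open>Comparable traces on \<open>M\<close> and total order along \<open>x\<close> or
  \<open>y\<close>\<close>

context mult_normal
begin

text \<open>Elementwise form of: \<open>N(a) \<inter> M\<close> and \<open>N(b) \<inter> M\<close>
  are comparable under inclusion.\<close>

definition interlaced :: "'a set \<Rightarrow> 'a set \<Rightarrow> 'a set \<Rightarrow> bool"
  where "interlaced M X Y \<longleftrightarrow> (\<forall>a\<in>X. \<forall>b\<in>Y. \<forall>m\<in>M. \<forall>n\<in>M.
    m \<in> N_of N a \<longrightarrow> n \<in> N_of N b \<longrightarrow> m \<in> N_of N b \<or> n \<in> N_of N a)"

lemma interlaced_sym: "interlaced M X Y \<Longrightarrow> interlaced M Y X"
  unfolding interlaced_def by blast

lemma interlacedD:
  "interlaced M X Y \<Longrightarrow> a \<in> X \<Longrightarrow> b \<in> Y \<Longrightarrow> m \<in> M \<Longrightarrow> n \<in> M \<Longrightarrow>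
    m \<in> N_of N a \<Longrightarrow> n \<in> N_of N b \<Longrightarrow> m \<in> N_of N b \<or> n \<in> N_of N a"
  unfolding interlaced_def by blast

definition total_along :: "'a set \<Rightarrow> 'a \<Rightarrow> bool"
  where "total_along M y \<longleftrightarrow>
    (\<forall>m\<in>M. \<forall>n\<in>M. N_of N (m * y) \<subseteq> N_of N (n * y) \<or> N_of N (n * y) \<subseteq> N_of N (m * y))"

text \<open>Exchanges the roles of multiplier and test element: a fixed \<open>k\<close> tested
  against varying \<open>n * y\<close> becomes a varying \<open>inverse n * m\<close> tested against
  a fixed element of \<open>y\<^sup>*\<close>. So incomparability along \<open>M\<close> shows up at
  test elements in \<open>M\<close>, although \<open>k\<close> need only lie in
  \<open>N\<close>.\<close>

lemma N_of_turn:
  assumes "m \<in> N" "n \<in> N" "k \<in> N"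
  shows "inverse n * m \<in> N_of N (y * inverse k * m) \<longleftrightarrow> k \<in> N_of N (n * y)"
  using N_of_mult_right_iff[OF assms(1), of "inverse n" "y * inverse k"]
    N_of_mult_right_iff'[OF inverse_in[OF assms(3)], of "inverse n" y]
    N_of_mult_left_iff'[OF assms(2), of k y]
  by simp

lemma not_total_alongE:
  assumes M: "subgroup M mult_group" "M \<subseteq> N" and "\<not> total_along M y"
  obtains b1 b2 l where "b1 \<in> star N y" "b2 \<in> star N y" "l \<in> M"
    "1 \<in> N_of N b1" "1 \<notin> N_of N b2" "l \<in> N_of N b2" "l \<notin> N_of N b1"
proof -
  obtain m n k j where m: "m \<in> M" and n: "n \<in> M"
    and k: "k \<in> N_of N (m * y)" "k \<notin> N_of N (n * y)"
    and j: "j \<in> N_of N (n * y)" "j \<notin> N_of N (m * y)"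
    using assms(3) unfolding total_along_def by blast
  have mn: "m \<in> N" "n \<in> N" "k \<in> N" "j \<in> N" using m n M k j by (auto simp: N_of_iff)
  have star: "y * inverse i * m \<in> star N y" if "i \<in> N" for i
    using star_memD(1)[OF star_self, of "inverse i * m" y] that mn
    by (simp add: mult_in inverse_in mult.assoc)
  have "inv\<^bsub>mult_group\<^esub> n = inverse n" using nonzero[OF mn(2)] by (rule inv_mult_group)
  then have l: "inverse n * m \<in> M"
    using subgroup.m_closed[OF M(1) subgroup.m_inv_closed[OF M(1) n] m] by simp
  have inv_m: "inverse m * m = 1" using nonzero[OF mn(1)] by simp
  show thesis
  proof (rule that)
    show "y * inverse k * m \<in> star N y" "y * inverse j * m \<in> star N y"
      using star mn by auto
    show "inverse n * m \<in> M" by (rule l)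
    show "1 \<in> N_of N (y * inverse k * m)" "1 \<notin> N_of N (y * inverse j * m)"
      using N_of_turn[of m m k y] N_of_turn[of m m j y] mn k j inv_m by auto
    show "inverse n * m \<in> N_of N (y * inverse j * m)" "inverse n * m \<notin> N_of N (y * inverse k * m)"
      using N_of_turn[of m n k y] N_of_turn[of m n j y] mn k j by auto
  qed
qed

text \<open>Comparison with \<open>b1\<close> and with \<open>b2\<close> shows that \<open>1\<close>
  and \<open>l\<close> lie in the same sets \<open>N(a)\<close>, \<open>a \<in> x\<^sup>*\<close>.
  As \<open>x\<^sup>*\<close> is invariant under \<open>N\<close> on both sides, this scales from
  \<open>1\<close> to any \<open>c\<close>.\<close>

lemma interlaced_stable:
  assumes inc: "interlaced M (star N x) (star N y)" and M: "1 \<in> M" "M \<subseteq> N"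
    and b: "b1 \<in> star N y" "b2 \<in> star N y" "l \<in> M"
      "1 \<in> N_of N b1" "1 \<notin> N_of N b2" "l \<in> N_of N b2" "l \<notin> N_of N b1"
    and a: "a \<in> star N x" and c: "c \<in> N"
  shows "l * c \<in> N_of N a \<longleftrightarrow> c \<in> N_of N a" and "c * l \<in> N_of N a \<longleftrightarrow> c \<in> N_of N a"
proof -
  have eq: "l \<in> N_of N a \<longleftrightarrow> 1 \<in> N_of N a" if "a \<in> star N x" for a
    using interlacedD[OF inc that b(1) b(3) M(1)] interlacedD[OF inc that b(2) M(1) b(3)] b by blast
  show "l * c \<in> N_of N a \<longleftrightarrow> c \<in> N_of N a"
    using eq[OF star_memD(1)[OF a inverse_in[OF c]]] c nonzero[OF c]
    by (simp add: N_of_mult_right_iff' inverse_in)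
  show "c * l \<in> N_of N a \<longleftrightarrow> c \<in> N_of N a"
    using eq[OF star_memD(2)[OF a inverse_in[OF c]]] c nonzero[OF c]
    by (simp add: N_of_mult_left_iff' inverse_in)
qed

text \<open>If both fail, the witnesses \<open>l\<close>, \<open>k\<close> of incomparability along \<open>y\<close>, \<open>x\<close> act trivially
  on the other side, so \<open>kl\<close> behaves like \<open>l\<close> along \<open>y\<close> and like \<open>k\<close> along \<open>x\<close>.\<close>

lemma total_along_dichotomy:
  assumes inc: "interlaced M (star N x) (star N y)" and M: "subgroup M mult_group" "M \<subseteq> N"
  shows "total_along M y \<or> total_along M x"
proof (rule ccontr)
  assume "\<not> ?thesis"
  then have ny: "\<not> total_along M y" and nx: "\<not> total_along M x" by auto
  obtain b1 b2 l where b: "b1 \<in> star N y" "b2 \<in> star N y" "l \<in> M"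
    "1 \<in> N_of N b1" "1 \<notin> N_of N b2" "l \<in> N_of N b2" "l \<notin> N_of N b1"
    using not_total_alongE[OF M ny] by metis
  obtain a1 a2 k where a: "a1 \<in> star N x" "a2 \<in> star N x" "k \<in> M"
    "1 \<in> N_of N a1" "1 \<notin> N_of N a2" "k \<in> N_of N a2" "k \<notin> N_of N a1"
    using not_total_alongE[OF M nx] by metis
  have 1: "1 \<in> M" using subgroup.one_closed[OF M(1)] by simp
  have kl: "k * l \<in> M" using subgroup.m_closed[OF M(1) a(3) b(3)] by simp
  have "k \<in> N" "l \<in> N" using a b M by auto
  then have "k * l \<in> N_of N b2" "k * l \<notin> N_of N a1"
    using interlaced_stable(1)[OF interlaced_sym[OF inc] 1 M(2) a b(2), of l]
      interlaced_stable(2)[OF inc 1 M(2) b a(1), of k] a b by auto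
  \<comment> \<open>\<open>1\<close> lies in \<open>N(a1)\<close> but not in \<open>N(b2)\<close>,
    and \<open>k * l\<close> in \<open>N(b2)\<close> but not in \<open>N(a1)\<close>.\<close>
  then show False
    using interlacedD[OF inc a(1) b(2) 1 kl] a b by blast
qed

section \<open>Finite index implies \<open>N - N = D\<close>\<close>

lemma carrier_Mod: "carrier (mult_group Mod N) = star N ` (UNIV - {0})"
  using normal.coset_eq[OF normal] by (auto simp: FactGroup_def RCOSETS_def star_def)

lemma finite_representatives:
  assumes "finite (carrier (mult_group Mod N))"
  obtains C where "finite C" "0 \<notin> C" "\<And>a. a \<noteq> 0 \<Longrightarrow> \<exists>c\<in>C. a \<in> star N c"
proof -
  obtain C where C: "C \<subseteq> UNIV - {0}" "finite C" "star N ` (UNIV - {0}) = star N ` C"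
    using finite_subset_image[of "star N ` (UNIV - {0})" "star N" "UNIV - {0}"] assms
    unfolding carrier_Mod by auto
  have "\<exists>c\<in>C. a \<in> star N c" if "a \<noteq> 0" for a
  proof -
    have "star N a \<in> star N ` C" using that C(3) by blast
    then show ?thesis using star_self[of a] by auto
  qed
  then show thesis using that C by blast
qed

lemma star_minus: "star N (- a) = star N a"
  using star_mult_left[OF neg_one, of a] by simp

lemma infinite_differences_in_coset:
  assumes "infinite (UNIV :: 'a set)" and fin: "finite (carrier (mult_group Mod N))"
  obtains Y c where "infinite Y" "c \<noteq> 0" "\<And>u v. u \<in> Y \<Longrightarrow> v \<in> Y \<Longrightarrow> u \<noteq> v \<Longrightarrow> u - v \<in> star N c"
proof -
  obtain h and s :: nat where h: "h ` carrier (mult_group Mod N) = {i. i < s}"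
    "inj_on h (carrier (mult_group Mod N))"
    using finite_imp_inj_to_nat_seg[OF fin] by blast
  have car: "star N (u - v) \<in> carrier (mult_group Mod N)" if "u \<noteq> v" for u v
    using that by (auto simp: carrier_Mod)
  \<comment> \<open>\<open>Ramsey2\<close> colours unordered pairs. The union joins the cosets of
    \<open>u - v\<close> and \<open>v - u\<close>, which agree because
    \<open>-1 \<in> N\<close>.\<close>
  define f where "f = (\<lambda>X. h (\<Union>u\<in>X. \<Union>v\<in>X - {u}. star N (u - v)))"
  have f: "f {u, v} = h (star N (u - v))" if "u \<noteq> v" for u v
  proof -
    have "{u, v} - {u} = {v}" "{u, v} - {v} = {u}" using that by auto
    moreover have "star N (v - u) = star N (u - v)" using star_minus[of "u - v"] by simp
    ultimately show ?thesis by (simp add: f_def)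
  qed
  have "\<forall>u\<in>UNIV. \<forall>v\<in>UNIV. u \<noteq> v \<longrightarrow> f {u, v} < s" using f car h(1) by auto
  from Ramsey2[OF assms(1) this] obtain Y t where Y: "infinite Y"
    and t: "\<forall>u\<in>Y. \<forall>v\<in>Y. u \<noteq> v \<longrightarrow> f {u, v} = t" by auto
  obtain u0 where u0: "u0 \<in> Y" using Y by fastforce
  obtain v0 where v0: "v0 \<in> Y" "u0 \<noteq> v0"
    using infinite_remove[OF Y, of u0] by (metis Diff_iff finite.emptyI insertI1 ex_in_conv)
  show thesis
  proof (rule that[OF Y])
    show "u0 - v0 \<noteq> 0" using v0 by simp
    fix u v assume uv: "u \<in> Y" "v \<in> Y" "u \<noteq> v"
    have "h (star N (u - v)) = h (star N (u0 - v0))" using t f uv u0 v0 by metis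
    then have "star N (u - v) = star N (u0 - v0)" using inj_onD[OF h(2)] car uv(3) v0(2) by blast
    then show "u - v \<in> star N (u0 - v0)" using star_self by metis
  qed
qed

end

text \<open>Restriction to \<open>C - {d}\<close> is injective on \<open>B\<close>. Applied to a
  colour class, \<open>det\<close> says that a line in direction \<open>d\<close> meets it at most
  once.\<close>

lemma card_determined_off_coordinate:
  assumes "finite C" and "finite F" and d: "d \<in> C" and B: "B \<subseteq> C \<rightarrow>\<^sub>E F"
    and det: "\<And>f g. f \<in> B \<Longrightarrow> g \<in> B \<Longrightarrow> (\<And>e. e \<in> C - {d} \<Longrightarrow> f e = g e) \<Longrightarrow> f d = g d"
  shows "card B \<le> card F ^ (card C - 1)"
proof -
  let ?r = "\<lambda>f. restrict f (C - {d})"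
  have "inj_on ?r B"
  proof (rule inj_onI)
    fix f g assume fg: "f \<in> B" "g \<in> B" and "?r f = ?r g"
    then have off: "f e = g e" if "e \<in> C - {d}" for e using that by (metis restrict_apply')
    have "f e = g e" if "e \<in> C" for e using off det[OF fg off] that by (cases "e = d") auto
    then show "f = g" using fg B by (intro PiE_ext[of f C "\<lambda>_. F" g]) auto
  qed
  moreover have "?r ` B \<subseteq> (C - {d}) \<rightarrow>\<^sub>E F" using B by (auto 0 3 simp: PiE_iff extensional_def split: if_splits dest!: subsetD[OF B])
  moreover have "finite ((C - {d}) \<rightarrow>\<^sub>E F)" using assms by (simp add: finite_PiE)
  ultimately have "card B \<le> card ((C - {d}) \<rightarrow>\<^sub>E F)" by (rule card_inj_on_le)
  then show ?thesis using assms by (simp add: card_PiE)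
qed

context mult_normal
begin

text \<open>Otherwise \<open>aN\<close> misses \<open>N - N\<close>. Take a finite \<open>F\<close> with all differences in \<open>aN\<close> (Ramsey)
  and colour \<open>f : C \<rightarrow> F\<close>, \<open>C\<close> a set of coset representatives, by the coset \<open>dN\<close> of
  \<open>\<Sum>\<^sub>d d f(d)\<close>. On a line in direction \<open>d\<close> the colour \<open>dN\<close> occurs at most once, so every colour
  occurs at most \<open>card F ^ (card C - 1)\<close> times, which is too little for \<open>|F| = |C| + 2\<close>.\<close>

lemma N_of_nonempty_of_finite_index:
  assumes inf: "infinite (UNIV :: 'a set)" and fin: "finite (carrier (mult_group Mod N))"
    and a: "a \<noteq> 0"
  shows "N_of N a \<noteq> {}"
proof
  assume empty: "N_of N a = {}"
  have no_diff: "n1 - n2 \<noteq> a * n" if "n1 \<in> N" "n2 \<in> N" "n \<in> N" for n n1 n2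
  proof
    assume eq: "n1 - n2 = a * n"
    have "a + n2 * inverse n = (a * n + n2) * inverse n"
      using nonzero[OF that(3)] by (simp add: distrib_right mult.assoc)
    also have "a * n + n2 = n1" by (simp flip: eq)
    finally have "a + n2 * inverse n \<in> N" using that by (simp add: mult_in inverse_in)
    then show False using empty that by (auto simp: N_of_def mult_in inverse_in)
  qed
  obtain C where C: "finite C" "0 \<notin> C" "\<And>a. a \<noteq> 0 \<Longrightarrow> \<exists>c\<in>C. a \<in> star N c"
    using finite_representatives[OF fin] by metis
  obtain d0 where d0: "d0 \<in> C" using C(3)[of 1] by auto
  obtain Y c where Y: "infinite Y" and c: "c \<noteq> 0"
    and diff: "\<And>u v. u \<in> Y \<Longrightarrow> v \<in> Y \<Longrightarrow> u \<noteq> v \<Longrightarrow> u - v \<in> star N c"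
    using infinite_differences_in_coset[OF inf fin] by metis
  obtain F0 where F0: "F0 \<subseteq> Y" "finite F0" "card F0 = card C + 2"
    using infinite_arbitrarily_large[OF Y] by metis
  \<comment> \<open>Left multiplication by \<open>a * inverse c\<close> moves the differences from
    \<open>cN\<close> to \<open>aN\<close>.\<close>
  define F where "F = (\<lambda>u. a * inverse c * u) ` F0"
  have "inj (\<lambda>u. a * inverse c * u)" using a c by (auto intro: injI)
  then have F: "finite F" "card F = card C + 2"
    using F0 by (auto simp: F_def card_image inj_on_subset)
  have F_diff: "\<exists>n\<in>N. u - v = a * n" if uv: "u \<in> F" "v \<in> F" "u \<noteq> v" for u v
  proof -
    obtain u' v' where uv': "u' \<in> F0" "v' \<in> F0" "u = a * inverse c * u'" "v = a * inverse c * v'"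
      using uv(1,2) by (auto simp: F_def)
    then obtain n where n: "n \<in> N" "u' - v' = c * n"
      using diff[of u' v'] F0 uv(3) by (auto simp: star_eq)
    have "u - v = a * inverse c * (u' - v')" using uv' by (simp add: right_diff_distrib)
    also have "\<dots> = a * n" using n c by (simp add: mult.assoc) (simp add: mult.assoc[symmetric])
    finally show ?thesis using n by blast
  qed
  define S where "S f = (\<Sum>d\<in>C. d * f d)" for f
  have S_diff: "S f - S g = d * (f d - g d)"
    if "d \<in> C" "\<And>e. e \<in> C - {d} \<Longrightarrow> f e = g e" for f g d
    using that by (simp add: S_def sum.remove[OF C(1) that(1)] right_diff_distrib)
  let ?P = "C \<rightarrow>\<^sub>E F"
  define A where "A d = {f \<in> ?P. S f \<in> star N d}" for d
  \<comment> \<open>A vanishing sum lies in no coset and counts as one more colour: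
    \<open>card C + 1\<close> classes against \<open>card F = card C + 2\<close>.\<close>
  define A0 where "A0 = {f \<in> ?P. S f = 0}"
  have "card (A d) \<le> card F ^ (card C - 1)" if d: "d \<in> C" for d
  proof (rule card_determined_off_coordinate[OF C(1) F(1) d])
    fix f g assume fg: "f \<in> A d" "g \<in> A d" and off: "\<And>e. e \<in> C - {d} \<Longrightarrow> f e = g e"
    have d': "d \<noteq> 0" using d C(2) by auto
    obtain n1 n2 where n: "n1 \<in> N" "n2 \<in> N" "S f = d * n1" "S g = d * n2"
      using fg by (auto simp: A_def star_eq)
    moreover have "S f - S g = d * (f d - g d)" using d off by (rule S_diff)
    ultimately have "d * (n1 - n2) = d * (f d - g d)" by (simp add: right_diff_distrib)
    \<comment> \<open>So \<open>f d - g d\<close> lies in \<open>N - N\<close>, whereas distinct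
      elements of \<open>F\<close> differ by an element of \<open>aN\<close>.\<close>
    then have eq: "n1 - n2 = f d - g d" using d' by simp
    show "f d = g d"
    proof (rule ccontr)
      assume "f d \<noteq> g d"
      moreover have "f d \<in> F" "g d \<in> F" using fg d by (auto simp: A_def)
      ultimately show False using F_diff no_diff n eq by metis
    qed
  qed (auto simp: A_def)
  then have cA: "(\<Sum>d\<in>C. card (A d)) \<le> card C * card F ^ (card C - 1)"
    using sum_bounded_above[of C "\<lambda>d. card (A d)"] by simp
  have cA0: "card A0 \<le> card F ^ (card C - 1)"
  proof (rule card_determined_off_coordinate[OF C(1) F(1) d0])
    fix f g assume fg: "f \<in> A0" "g \<in> A0" and off: "\<And>e. e \<in> C - {d0} \<Longrightarrow> f e = g e"
    have "d0 \<noteq> 0" using d0 C(2) by auto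
    moreover have "S f - S g = d0 * (f d0 - g d0)" using d0 off by (rule S_diff)
    ultimately show "f d0 = g d0" using fg by (simp add: A0_def)
  qed (auto simp: A0_def)
  have "?P = A0 \<union> (\<Union>d\<in>C. A d)" using C(3) by (auto simp: A_def A0_def)
  then have "card ?P \<le> card A0 + card (\<Union>d\<in>C. A d)" by (metis card_Un_le)
  also have "\<dots> \<le> card A0 + (\<Sum>d\<in>C. card (A d))" using card_UN_le[OF C(1)] by auto
  also have "\<dots> \<le> (card C + 1) * card F ^ (card C - 1)" using cA cA0 by simp
  also have "\<dots> < card F * card F ^ (card C - 1)" using F by simp
  also have "\<dots> = card F ^ card C"
    using C(1) d0 by (metis card_gt_0_iff empty_iff power_minus_mult mult.commute)
  also have "\<dots> = card ?P" using C(1) by (simp add: card_PiE)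
  finally show False by simp
qed

end

section \<open>Distance in V-graphs\<close>

lemma pair_graph_arc_sym: "pair_graph \<Delta> \<Longrightarrow> (u, v) \<in> parcs \<Delta> \<Longrightarrow> (v, u) \<in> parcs \<Delta>"
proof -
  assume "pair_graph \<Delta>" and a: "(u, v) \<in> parcs \<Delta>"
  then interpret pair_graph \<Delta> by simp
  show ?thesis using a pair_sym_arcs by (auto simp: symmetric_def dest: symD)
qed

lemma (in wf_digraph) awalk_cost_unit: "awalk_cost (\<lambda>_. 1) p = real (length p)"
  by (induction p) (auto simp: awalk_cost_def)

lemma graph_dist_le_walk:
  assumes "pair_graph \<Delta>" and "pre_digraph.awalk (with_proj \<Delta>) u p v"
  shows "graph_dist \<Delta> u v \<le> length p"
proof -
  interpret pair_graph \<Delta> by (rule assms(1))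
  show ?thesis using min_cost_le_walk_cost[of u p v "\<lambda>_. 1"] assms(2)
    by (simp add: graph_dist_def awalk_cost_unit)
qed

lemma graph_dist_le_1_iff:
  assumes "pair_graph \<Delta>" and u: "u \<in> pverts \<Delta>"
  shows "graph_dist \<Delta> u v \<le> 1 \<longleftrightarrow> u = v \<or> (u, v) \<in> parcs \<Delta>"
proof -
  interpret pair_graph \<Delta> by (rule assms(1))
  show ?thesis
  proof
    assume d: "graph_dist \<Delta> u v \<le> 1"
    show "u = v \<or> (u, v) \<in> parcs \<Delta>"
    proof (rule ccontr)
      assume no: "\<not> ?thesis"
      have "2 \<le> length p" if "awalk u p v" for p
      proof -
        consider "p = []" | e where "p = [e]" | "2 \<le> length p"
          by (cases p rule: list.exhaust; cases "tl p") auto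
        then show ?thesis using that no by cases (auto simp: awalk_Nil_iff awalk_Cons_iff)
      qed
      then have "2 \<le> graph_dist \<Delta> u v"
        unfolding graph_dist_def \<mu>_def
        by (intro INF_greatest) (simp add: awalk_cost_unit numeral_le_real_of_nat_iff)
      then have "(2::ereal) \<le> 1" using d order_trans by blast
      then show False by simp
    qed
  next
    assume "u = v \<or> (u, v) \<in> parcs \<Delta>"
    then show "graph_dist \<Delta> u v \<le> 1"
    proof
      assume "u = v"
      then show ?thesis using graph_dist_le_walk[OF assms(1), of u "[]" v] u
        by (simp add: awalk_Nil_iff order_trans)
    next
      assume "(u, v) \<in> parcs \<Delta>"
      then show ?thesis using graph_dist_le_walk[OF assms(1), of u "[(u, v)]" v] u
        by (auto simp: awalk_Nil_iff awalk_Cons_iff one_ereal_def dest: wellformed')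
    qed
  qed
qed

lemma graph_dist_le_2:
  assumes "pair_graph \<Delta>" and "w \<in> pverts \<Delta>"
    and "graph_dist \<Delta> w u \<le> 1" and "graph_dist \<Delta> w v \<le> 1"
  shows "graph_dist \<Delta> u v \<le> 2"
proof -
  interpret pair_graph \<Delta> by (rule assms(1))
  have wu: "w = u \<or> (u, w) \<in> parcs \<Delta>" and wv: "w = v \<or> (w, v) \<in> parcs \<Delta>"
    using graph_dist_le_1_iff[OF assms(1,2)] assms(3,4) pair_graph_arc_sym[OF assms(1)] by auto
  have "\<exists>p. awalk u p v \<and> length p \<le> 2"
  proof (cases "w = u"; cases "w = v")
    assume "w = u" "w = v"
    then show ?thesis using assms(2) by (intro exI[of _ "[]"]) (auto simp: awalk_Nil_iff)
  next
    assume "w = u" "w \<noteq> v"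
    then show ?thesis using wv wellformed'
      by (intro exI[of _ "[(w, v)]"]) (auto simp: awalk_Nil_iff awalk_Cons_iff)
  next
    assume "w \<noteq> u" "w = v"
    then show ?thesis using wu wellformed'
      by (intro exI[of _ "[(u, w)]"]) (auto simp: awalk_Nil_iff awalk_Cons_iff)
  next
    assume "w \<noteq> u" "w \<noteq> v"
    then show ?thesis using wu wv wellformed'
      by (intro exI[of _ "[(u, w), (w, v)]"]) (auto simp: awalk_Nil_iff awalk_Cons_iff)
  qed
  then obtain p where "awalk u p v" "length p \<le> 2" by blast
  then have "graph_dist \<Delta> u v \<le> length p" "ereal (length p) \<le> 2"
    using graph_dist_le_walk[OF assms(1)] by (auto simp: numeral_eq_ereal)
  then show ?thesis by (rule order_trans)
qed

text \<open>The trivial coset is not a vertex, so the distance is consulted only outside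
  \<open>N\<close>.\<close>

definition V_perp :: "'a::division_ring set \<Rightarrow> 'a set pair_pre_digraph \<Rightarrow> 'a \<Rightarrow> 'a \<Rightarrow> bool"
  where "V_perp N \<Delta> a b \<longleftrightarrow> a \<noteq> 0 \<and> b \<noteq> 0 \<and>
    (a \<in> N \<or> b \<in> N \<or> graph_dist \<Delta> (star N a) (star N b) \<le> 1)"

locale V_graph_normal = mult_normal N for N :: "'a::division_ring set" +
  fixes \<Delta> :: "'a set pair_pre_digraph"
  assumes V: "V_graph N \<Delta>"
    and inf: "infinite (UNIV :: 'a set)" and fin: "finite (carrier (mult_group Mod N))"
begin

lemma graph: "pair_graph \<Delta>"
  using V by (simp add: V_graph_def)

lemma star_mult: "a \<noteq> 0 \<Longrightarrow> b \<noteq> 0 \<Longrightarrow>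
    star N a \<otimes>\<^bsub>mult_group Mod N\<^esub> star N b = star N (a * b)"
  using normal.rcos_sum[OF normal, of a b] normal.coset_eq[OF normal]
  by (simp add: star_def FactGroup_def)

lemma star_eq_self_iff: "star N a = N \<longleftrightarrow> a \<in> N"
  using star_eq_iff[of 1 a] one_in by (auto simp: star_eq)

lemma star_in_pverts_iff: "a \<noteq> 0 \<Longrightarrow> star N a \<in> pverts \<Delta> \<longleftrightarrow> a \<notin> N"
  using V star_eq_self_iff[of a] unfolding V_graph_def carrier_Mod by auto

lemma dist_sym:
  assumes "a \<noteq> 0" "b \<noteq> 0" "a \<notin> N" "b \<notin> N" "graph_dist \<Delta> (star N a) (star N b) \<le> 1"
  shows "graph_dist \<Delta> (star N b) (star N a) \<le> 1"
  using assms graph_dist_le_1_iff[OF graph] star_in_pverts_iff pair_graph_arc_sym[OF graph] by metis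

lemma V1:
  assumes "a \<noteq> 0" "b \<noteq> 0" "a \<notin> N" "b \<notin> N" "a - b \<in> N"
  shows "graph_dist \<Delta> (star N a) (star N b) \<le> 1"
  using V assms by (auto simp: V_graph_def)

lemma V2:
  assumes "a \<noteq> 0" "b \<noteq> 0" "a \<notin> N" "b \<notin> N" "graph_dist \<Delta> (star N a) (star N b) \<le> 1"
  shows "graph_dist \<Delta> (star N (inverse a)) (star N b) \<le> 1"
  using V assms by (auto simp: V_graph_def)

lemma V3:
  assumes "a \<noteq> 0" "b \<noteq> 0" "c \<noteq> 0" "a \<notin> N" "b \<notin> N" "c \<notin> N" "a * b \<notin> N"
    and "graph_dist \<Delta> (star N a) (star N c) \<le> 1" and "graph_dist \<Delta> (star N (a * b)) (star N c) \<le> 1"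
  shows "graph_dist \<Delta> (star N b) (star N c) \<le> 1"
  using V assms star_mult[OF assms(1,2)] unfolding V_graph_def by auto

text \<open>(V3) is a cancellation law. Closure under products follows by applying it to
  \<open>inverse a\<close> and \<open>a * b\<close>, whose product is \<open>b\<close>.\<close>

lemma V_perp_mult:
  assumes ac: "V_perp N \<Delta> a c" and bc: "V_perp N \<Delta> b c"
  shows "V_perp N \<Delta> (a * b) c"
proof -
  have nz: "a \<noteq> 0" "b \<noteq> 0" "c \<noteq> 0" using assms by (auto simp: V_perp_def)
  consider "c \<in> N \<or> a * b \<in> N" | "c \<notin> N" "a \<in> N" | "c \<notin> N" "b \<in> N"
    | "c \<notin> N" "a * b \<notin> N" "a \<notin> N" "b \<notin> N" by blast
  then show ?thesis
  proof cases
    case 4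
    have "inverse a * (a * b) = b" using nz by (simp add: mult.assoc[symmetric])
    then have "graph_dist \<Delta> (star N (a * b)) (star N c) \<le> 1"
      using V3[of "inverse a" "a * b" c] V2[of a c] 4 nz ac bc
      by (auto simp: V_perp_def inverse_in_iff)
    then show ?thesis using nz by (simp add: V_perp_def)
  qed (use assms in \<open>auto simp: V_perp_def star_mult_left star_mult_right mult_left_iff mult_right_iff\<close>)
qed

sublocale perp_relation N "V_perp N \<Delta>"
proof unfold_locales
  fix a b c n :: 'a
  show "V_perp N \<Delta> a b \<Longrightarrow> a \<noteq> 0" by (simp add: V_perp_def)
  show "V_perp N \<Delta> a b \<Longrightarrow> V_perp N \<Delta> b a" using dist_sym[of a b] by (auto simp: V_perp_def)
  show "a \<noteq> 0 \<Longrightarrow> V_perp N \<Delta> a a"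
    using graph_dist_le_1_iff[OF graph, of "star N a" "star N a"] star_in_pverts_iff[of a]
    by (auto simp: V_perp_def)
  show "n \<in> N \<Longrightarrow> b \<noteq> 0 \<Longrightarrow> V_perp N \<Delta> n b" by (auto simp: V_perp_def nonzero)
  show "V_perp N \<Delta> a c \<Longrightarrow> V_perp N \<Delta> b c \<Longrightarrow> V_perp N \<Delta> (a * b) c" by (rule V_perp_mult)
  show "V_perp N \<Delta> a c \<Longrightarrow> V_perp N \<Delta> (inverse a) c"
    using V2[of a c] by (auto simp: V_perp_def inverse_in_iff)
  show "a - b \<in> N \<Longrightarrow> a \<noteq> 0 \<Longrightarrow> b \<noteq> 0 \<Longrightarrow> V_perp N \<Delta> a b"
    using V1[of a b] by (auto simp: V_perp_def)
  show "a \<noteq> 0 \<Longrightarrow> N_of N a \<noteq> {}" using N_of_nonempty_of_finite_index[OF inf fin] .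
qed

lemma dist_ge_3_imp_far:
  assumes "a \<noteq> 0" "b \<noteq> 0" "a \<notin> N" "b \<notin> N" and d: "graph_dist \<Delta> (star N a) (star N b) \<ge> 3"
  shows "far a b"
  unfolding far_def
proof (intro conjI allI impI)
  fix c assume c: "V_perp N \<Delta> c a" "V_perp N \<Delta> c b"
  show "c \<in> N"
  proof (rule ccontr)
    assume "c \<notin> N"
    then have "graph_dist \<Delta> (star N a) (star N b) \<le> 2"
      using c assms graph_dist_le_2[OF graph, of "star N c"] star_in_pverts_iff[of c]
      by (auto simp: V_perp_def)
    then have "(3::ereal) \<le> 2" using d order_trans by blast
    then show False by simp
  qed
qed (use assms in auto)

text \<open>Since \<open>(b + m) - b(a + 1) = m - ba\<close>, the element \<open>b + m\<close> is
  perpendicular to \<open>b(a + 1)\<close>. It is also perpendicular to \<open>b\<close>, which can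
  be cancelled.\<close>

lemma perp_of_mult_diff:
  assumes far: "far a b" and m: "m \<in> N" and a: "a + 1 \<notin> N" and w: "b * a - m \<in> N"
  shows "V_perp N \<Delta> (a + 1) (b + m)"
proof -
  have nz: "a + 1 \<noteq> 0" "b + m \<noteq> 0" "b \<noteq> 0"
    using far add_nonzero one_in m by (auto simp: far_def)
  have "(b + m) - b * (a + 1) = - (b * a - m)" by (simp add: distrib_left)
  then have "V_perp N \<Delta> (b + m) (b * (a + 1))"
    using w nz by (intro perp_diff) (auto simp only: minus_in_iff mult_eq_0_iff)
  moreover have "V_perp N \<Delta> (b + m) b" using nz m by (intro perp_diff) auto
  ultimately show ?thesis using perp_mult2_left_cancel perp_sym by blast
qed

end

section \<open>Property (3 1/2) and the traces on \<open>M\<close>\<close>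

locale half_property = V_graph_normal N \<Delta> for N :: "'a::division_ring set" and \<Delta> +
  fixes \<Sigma> :: "('a \<Rightarrow> 'a) set" and M :: "'a set" and x y :: 'a
  assumes \<Sigma>: "subgroup \<Sigma> (BijGroup (carrier mult_group))"
    and \<Sigma>_N: "\<And>\<sigma>. \<sigma> \<in> \<Sigma> \<Longrightarrow> \<sigma> ` N = N"
    and \<Sigma>_star: "\<And>\<sigma> a. \<sigma> \<in> \<Sigma> \<Longrightarrow> a \<noteq> 0 \<Longrightarrow> \<sigma> ` star N a = star N (\<sigma> a)"
    and M: "subgroup M mult_group" "M \<subseteq> N"
    and x: "x \<noteq> 0" "x \<notin> N" and y: "y \<noteq> 0" "y \<notin> N"
    and half: "property_3_half N \<Delta> x y \<Sigma> M"
begin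

lemma far_xy: "far x y"
  using half x y by (intro dist_ge_3_imp_far) (auto simp: property_3_half_def)

lemma \<Sigma>_bij: "\<sigma> \<in> \<Sigma> \<Longrightarrow> bij_betw \<sigma> (UNIV - {0}) (UNIV - {0})"
  using subgroup.subset[OF \<Sigma>] by (auto simp: BijGroup_def Bij_def)

lemma \<Sigma>_in_N_iff:
  assumes "\<sigma> \<in> \<Sigma>" and "a \<noteq> 0" shows "\<sigma> a \<in> N \<longleftrightarrow> a \<in> N"
proof -
  have "\<sigma> a \<in> \<sigma> ` N \<longleftrightarrow> a \<in> N"
    using \<Sigma>_bij[OF assms(1)] assms(2) zero_notin
    by (intro inj_on_image_mem_iff[of \<sigma> "UNIV - {0}"]) (auto simp: bij_betw_def)
  then show ?thesis using \<Sigma>_N[OF assms(1)] by simp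
qed

lemma \<Sigma>_nonzero: "\<sigma> \<in> \<Sigma> \<Longrightarrow> a \<noteq> 0 \<Longrightarrow> \<sigma> a \<noteq> 0"
  using \<Sigma>_bij[of \<sigma>] by (auto simp: bij_betw_def)

lemma \<Sigma>_star_eq_iff:
  assumes "\<sigma> \<in> \<Sigma>" and "a \<noteq> 0" and "b \<noteq> 0"
  shows "star N (\<sigma> a) = star N (\<sigma> b) \<longleftrightarrow> star N a = star N b"
proof -
  have "star N c \<subseteq> UNIV - {0}" if "c \<noteq> 0" for c
    using that zero_notin by (auto simp: star_eq)
  then have "\<sigma> ` star N a = \<sigma> ` star N b \<longleftrightarrow> star N a = star N b"
    using \<Sigma>_bij[OF assms(1)] assms(2,3) by (intro inj_on_image_eq_iff) (auto simp: bij_betw_def)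
  then show ?thesis using \<Sigma>_star assms by simp
qed

lemma star_eq_in_N_iff: "star N a = star N b \<Longrightarrow> a \<in> N \<longleftrightarrow> b \<in> N"
  using mult_right_iff by (auto simp: star_eq_iff)

text \<open>For \<open>k \<in> M\<close> this makes passing from \<open>a\<close> to
  \<open>\<sigma> a\<close> harmless: the trace of \<open>N(a)\<close> on \<open>M\<close> is
  unchanged.\<close>

lemma \<Sigma>_shift_in_N_iff:
  assumes \<sigma>: "\<sigma> \<in> \<Sigma>" and a: "a \<noteq> 0" "a \<notin> N" and k: "k \<in> M"
  shows "\<sigma> a + k \<in> N \<longleftrightarrow> a + k \<in> N"
proof -
  have "star N (\<sigma> (a + k)) = star N (\<sigma> a + k)"
    using half \<sigma> a k by (auto simp: property_3_half_def)
  then have "\<sigma> (a + k) \<in> N \<longleftrightarrow> \<sigma> a + k \<in> N" by (rule star_eq_in_N_iff)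
  moreover have "a + k \<noteq> 0" using a k M(2) add_nonzero by blast
  ultimately show ?thesis using \<Sigma>_in_N_iff[OF \<sigma>] by simp
qed

lemma far_stars: "a \<in> star N x \<Longrightarrow> b \<in> star N y \<Longrightarrow> far a b"
  using far_star_left[OF far_sym[OF far_star_left[OF far_sym[OF far_xy]]]] .

text \<open>If \<open>a + 1\<close> and \<open>b + m\<close> are perpendicular, the cosets of
  \<open>x\<close>, \<open>a + 1\<close>, \<open>b + m\<close>, \<open>y\<close> form a path.
  Property (3 1/2) then yields \<open>\<sigma>\<close> breaking it, and
  \<open>a' = \<sigma> a\<close>.\<close>

lemma moved_apart:
  assumes a: "a \<in> star N x" and b: "b \<in> star N y" and m: "m \<in> M"
    and a1: "a + 1 \<notin> N" and bm: "b + m \<notin> N"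
  obtains a' where "far a' b" and "a' + 1 \<notin> N" and "a' + m \<in> N \<longleftrightarrow> a + m \<in> N"
    and "\<not> V_perp N \<Delta> (a' + 1) (b + m)"
proof (cases "V_perp N \<Delta> (a + 1) (b + m)")
  case False
  then show thesis using that far_stars[OF a b] a1 by blast
next
  case True
  have far: "far a b" by (rule far_stars[OF a b])
  have stars: "star N a = star N x" "star N b = star N y"
    using a b star_mult_right by (auto simp: star_eq[of x] star_eq[of y])
  have mN: "m \<in> N" using m M by auto
  have nz: "a \<noteq> 0" "b \<noteq> 0" "a \<notin> N" "b \<notin> N" using far by (auto simp: far_def)
  have nz': "a + 1 \<noteq> 0" "b + m \<noteq> 0"
    using True perp_nonzero perp_nonzero2 by blast+
  have ra: "V_perp N \<Delta> (a + 1) a" using nz nz' one_in by (intro perp_diff) auto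
  have sb: "V_perp N \<Delta> (b + m) b" using nz nz' mN by (intro perp_diff) auto
  have arc: "(star N u, star N v) \<in> parcs \<Delta>"
    if "V_perp N \<Delta> u v" "u \<notin> N" "v \<notin> N" "star N u \<noteq> star N v" for u v
    using that graph_dist_le_1_iff[OF graph, of "star N u" "star N v"] star_in_pverts_iff[of u]
    by (auto simp: V_perp_def)
  have perp_star: "V_perp N \<Delta> u w" if "V_perp N \<Delta> v w" "star N u = star N v" for u v w
  proof -
    obtain n where "n \<in> N" "u = v * n" using \<open>star N u = star N v\<close> star_eq_iff by metis
    then show ?thesis using that perp_mult perp_N[OF _ perp_nonzero2] by blast
  qed
  \<comment> \<open>Edges, unlike perpendicularity, require distinct vertices. An equality would
    make \<open>a + 1\<close> or \<open>b + m\<close> perpendicular to both \<open>a\<close> and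
    \<open>b\<close>, hence an element of \<open>N\<close>.\<close>
  have n1: "star N a \<noteq> star N (a + 1)"
    using perp_star[OF True, of a] farD[OF far perp_sym sb] bm by blast
  have n2: "star N (a + 1) \<noteq> star N (b + m)"
    using farD[OF far ra perp_star[OF sb]] a1 by blast
  have n3: "star N (b + m) \<noteq> star N b"
    using perp_star[OF perp_sym[OF True], of b] farD[OF far ra] perp_sym a1 by metis
  have verts: "star N x \<in> pverts \<Delta>" "star N (a + 1) \<in> pverts \<Delta>"
    "star N (b + m) \<in> pverts \<Delta>" "star N y \<in> pverts \<Delta>"
    using star_in_pverts_iff x y nz' a1 bm by blast+
  have path: "vwalk [star N x, star N (a + 1), star N (b + m), star N y] \<Delta>"
    using arc[OF perp_sym[OF ra] nz(3) a1 n1] arc[OF True a1 bm n2] arc[OF sb bm nz(4) n3] verts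
    by (simp add: vwalk_def stars)
  have half3: "\<forall>r \<in> carrier mult_group - N. \<forall>s \<in> carrier mult_group - N.
      vwalk [star N x, star N r, star N s, star N y] \<Delta> \<longrightarrow>
      (\<exists>\<sigma>\<in>\<Sigma>. graph_dist \<Delta> (star N (\<sigma> x)) (star N y) \<ge> 3 \<and>
         \<not> vwalk [star N (\<sigma> x), star N (\<sigma> r), star N s, star N y] \<Delta>)"
    using half unfolding property_3_half_def by blast
  have rs: "a + 1 \<in> carrier mult_group - N" "b + m \<in> carrier mult_group - N"
    using nz' a1 bm by auto
  obtain \<sigma> where \<sigma>: "\<sigma> \<in> \<Sigma>" and d: "graph_dist \<Delta> (star N (\<sigma> x)) (star N y) \<ge> 3"
    and np: "\<not> vwalk [star N (\<sigma> x), star N (\<sigma> (a + 1)), star N (b + m), star N y] \<Delta>"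
    using half3 rs path by blast
  have 1: "1 \<in> M" using subgroup.one_closed[OF M(1)] by simp
  have \<sigma>a: "\<sigma> a \<noteq> 0" "\<sigma> a \<notin> N" using \<Sigma>_nonzero \<Sigma>_in_N_iff \<sigma> nz by auto
  have \<sigma>x: "star N (\<sigma> x) = star N (\<sigma> a)" using \<Sigma>_star_eq_iff[OF \<sigma>] x nz stars by simp
  have \<sigma>1: "star N (\<sigma> (a + 1)) = star N (\<sigma> a + 1)"
    using half \<sigma> nz 1 by (auto simp: property_3_half_def)
  have r1: "\<sigma> a + 1 \<notin> N" using \<Sigma>_shift_in_N_iff[OF \<sigma> nz(1,3) 1] a1 by simp
  have r0: "\<sigma> a + 1 \<noteq> 0" using \<sigma>a add_nonzero one_in by blast
  have far': "far (\<sigma> a) b" using d \<sigma>x stars \<sigma>a nz by (intro dist_ge_3_imp_far) auto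
  have r\<sigma>: "V_perp N \<Delta> (\<sigma> a + 1) (\<sigma> a)" using \<sigma>a r0 one_in by (intro perp_diff) auto
  have "\<not> V_perp N \<Delta> (\<sigma> a + 1) (b + m)"
  proof
    assume p: "V_perp N \<Delta> (\<sigma> a + 1) (b + m)"
    have m1: "star N (\<sigma> a) \<noteq> star N (\<sigma> a + 1)"
      using \<Sigma>_star_eq_iff[OF \<sigma> nz(1) nz'(1)] \<sigma>1 n1 by simp
    have m2: "star N (\<sigma> a + 1) \<noteq> star N (b + m)"
      using farD[OF far' r\<sigma> perp_star[OF sb]] r1 by blast
    have \<sigma>v: "star N (\<sigma> a) \<in> pverts \<Delta>" "star N (\<sigma> a + 1) \<in> pverts \<Delta>"
      using star_in_pverts_iff \<sigma>a r0 r1 by blast+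
    have "vwalk [star N (\<sigma> x), star N (\<sigma> (a + 1)), star N (b + m), star N y] \<Delta>"
      using arc[OF perp_sym[OF r\<sigma>] \<sigma>a(2) r1 m1] arc[OF p r1 bm m2] arc[OF sb bm nz(4) n3]
        verts \<sigma>v by (simp add: vwalk_def stars \<sigma>x \<sigma>1)
    then show False using np by simp
  qed
  then show thesis
    using that far' r1 \<Sigma>_shift_in_N_iff[OF \<sigma> nz(1,3) m] by blast
qed

lemma interlaced_M: "interlaced M (star N x) (star N y)"
  unfolding interlaced_def
proof (intro ballI impI)
  fix a b m n assume a: "a \<in> star N x" and b: "b \<in> star N y" and mn: "m \<in> M" "n \<in> M"
    and m: "m \<in> N_of N a" and n: "n \<in> N_of N b"
  show "m \<in> N_of N b \<or> n \<in> N_of N a"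
  proof (rule ccontr)
    assume not: "\<not> ?thesis"
    have nN: "n \<in> N" and mN: "m \<in> N" and ni: "inverse n \<in> N"
      using n m by (auto simp: N_of_iff inverse_in)
    have "inv\<^bsub>mult_group\<^esub> n = inverse n" using nonzero[OF nN] by (rule inv_mult_group)
    then have k: "m * inverse n \<in> M"
      using subgroup.m_closed[OF M(1) mn(1) subgroup.m_inv_closed[OF M(1) mn(2)]] by simp
    have kN: "m * inverse n \<in> N" using k M by auto
    \<comment> \<open>Scaling by \<open>inverse n\<close> turns the test element \<open>n\<close>
      into \<open>1\<close> and keeps the other one in \<open>M\<close>.\<close>
    let ?a = "a * inverse n" and ?b = "b * inverse n" and ?k = "m * inverse n"
    have stars: "?a \<in> star N x" "?b \<in> star N y" using a b ni star_memD by auto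
    have one: "n * inverse n = 1" using nonzero[OF nN] by simp
    have a1: "?a + 1 \<notin> N" "?b + 1 \<in> N"
      using not n one_in N_of_mult_right_iff[OF ni, of n] by (auto simp: one N_of_iff)
    have ak: "?a + ?k \<in> N" "?b + ?k \<notin> N"
      using not m mN kN N_of_mult_right_iff[OF ni, of m] by (auto simp: N_of_iff)
    obtain a' where far: "far a' ?b" and a': "a' + 1 \<notin> N" "a' + ?k \<in> N"
      and np: "\<not> V_perp N \<Delta> (a' + 1) (?b + ?k)"
      using moved_apart[OF stars k a1(1) ak(2)] ak by metis
    \<comment> \<open>The product rule at test elements \<open>1\<close> and \<open>?k\<close>
      forces exactly the perpendicularity that the choice of \<open>a'\<close> excludes.\<close>
    have "?b * a' - 1 * ?k \<in> N"
      using N_of_mult[OF far_sym[OF far], of 1 ?k] a1 a' one_in kN by (auto simp: N_of_iff)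
    then show False using perp_of_mult_diff[OF far kN a'(1)] np by simp
  qed
qed

lemma neg_one_in_M: "- 1 \<in> M"
  using half by (simp add: property_3_half_def)

end

section \<open>The partially ordered group attached to \<open>y\<close>\<close>

context mult_normal
begin

abbreviation N_group :: "'a monoid"
  where "N_group \<equiv> mult_group\<lparr>carrier := N\<rparr>"

lemma group_N: "group N_group"
  using group.subgroup_imp_group[OF group_mult_group subgroup] .

lemma N_of_mult_left_eq_iff:
  "k \<in> N \<Longrightarrow> N_of N (k * a) = N_of N (k * b) \<longleftrightarrow> N_of N a = N_of N b"
  using N_of_mult_left_subset_iff by blast

text \<open>A right factor \<open>k\<close> is moved past \<open>y\<close> as the conjugate
  \<open>inverse y * k * y \<in> N\<close>. This yields normality of \<open>U_of N y\<close> and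
  right invariance of the order.\<close>

lemma N_of_mult_conj_subset_iff:
  assumes "y \<noteq> 0" and "k \<in> N"
  shows "N_of N (m * k * y) \<subseteq> N_of N (n * k * y) \<longleftrightarrow> N_of N (m * y) \<subseteq> N_of N (n * y)"
proof -
  have "i * k * y = i * y * (inverse y * k * y)" for i
    using assms(1) by (metis mult.assoc mult_1_left right_inverse)
  then show ?thesis using N_of_mult_right_subset_iff[OF conj_in'[OF assms]] by metis
qed

lemma U_of_iff: "u \<in> U_of N y \<longleftrightarrow> u \<in> N \<and> N_of N (u * y) = N_of N y"
  by (simp add: U_of_def)

lemma inv_N_group: "n \<in> N \<Longrightarrow> inv\<^bsub>N_group\<^esub> n = inverse n"
  by (rule group.inv_equality[OF group_N]) (auto simp: nonzero inverse_in)

lemma U_of_normal: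
  assumes y: "y \<noteq> 0" shows "U_of N y \<lhd> N_group"
proof (rule group.normal_invI[OF group_N])
  have "inverse n \<in> U_of N y" if "n \<in> U_of N y" for n
    using that N_of_mult_left_eq_iff[of n "inverse n * y" y] nonzero[of n]
    by (auto simp: U_of_iff inverse_in mult.assoc[symmetric])
  moreover have "m * n \<in> U_of N y" if "m \<in> U_of N y" "n \<in> U_of N y" for m n
    using that N_of_mult_left_eq_iff[of m "n * y" y] by (auto simp: U_of_iff mult_in mult.assoc)
  moreover have "U_of N y \<noteq> {}" using one_in U_of_iff[of 1 y] by auto
  ultimately show "subgroup (U_of N y) N_group"
    by (intro group.subgroupI[OF group_N]) (auto simp: U_of_iff inv_N_group)
next
  fix n u assume "n \<in> carrier N_group" and u: "u \<in> U_of N y"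
  then have n: "n \<in> N" by simp
  have uN: "u \<in> N" "N_of N (u * y) = N_of N (1 * y)" using u by (auto simp: U_of_iff)
  then have "N_of N (u * inverse n * y) = N_of N (1 * inverse n * y)"
    using N_of_mult_conj_subset_iff[OF y inverse_in[OF n]] by blast
  then have "N_of N (n * (u * inverse n * y)) = N_of N (n * (inverse n * y))"
    using N_of_mult_left_eq_iff[OF n] by simp
  then have "N_of N (n * u * inverse n * y) = N_of N y"
    using nonzero[OF n] by (simp add: mult.assoc[symmetric])
  then show "n \<otimes>\<^bsub>N_group\<^esub> u \<otimes>\<^bsub>N_group\<^esub> inv\<^bsub>N_group\<^esub> n \<in> U_of N y"
    using n uN by (simp add: U_of_iff inv_N_group mult_in inverse_in)
qed

lemma phi_of_eq_iff:
  assumes y: "y \<noteq> 0" and mn: "m \<in> N" "n \<in> N"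
  shows "phi_of N y m = phi_of N y n \<longleftrightarrow> N_of N (m * y) = N_of N (n * y)"
proof -
  have mem: "k \<in> phi_of N y i \<longleftrightarrow> k \<in> N \<and> N_of N (k * y) = N_of N (i * y)" if i: "i \<in> N" for i k
  proof
    assume "k \<in> phi_of N y i"
    then obtain u where "u \<in> U_of N y" "k = i * u" by (auto simp: phi_of_def l_coset_def)
    then show "k \<in> N \<and> N_of N (k * y) = N_of N (i * y)"
      using N_of_mult_left_eq_iff[OF i, of "u * y" y] i by (auto simp: U_of_iff mult_in mult.assoc)
  next
    assume k: "k \<in> N \<and> N_of N (k * y) = N_of N (i * y)"
    have eq: "k = i * (inverse i * k)" using nonzero[OF i] by (simp add: mult.assoc[symmetric])
    then have "N_of N (i * (inverse i * k * y)) = N_of N (i * y)" using k by (metis mult.assoc)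
    then have "inverse i * k \<in> U_of N y"
      using k i N_of_mult_left_eq_iff[OF i] by (simp add: U_of_iff mult_in inverse_in)
    then show "k \<in> phi_of N y i" using eq by (auto simp: phi_of_def l_coset_def)
  qed
  show ?thesis
  proof
    assume "phi_of N y m = phi_of N y n"
    then show "N_of N (m * y) = N_of N (n * y)" using mem[OF mn(1), of m] mem[OF mn(2), of m] mn by simp
  qed (use mem mn in blast)
qed

lemma phi_of_rel_iff:
  assumes y: "y \<noteq> 0" and mn: "m \<in> N" "n \<in> N"
  shows "(phi_of N y m, phi_of N y n) \<in> Gamma_rel N y \<longleftrightarrow> N_of N (m * y) \<subseteq> N_of N (n * y)"
proof
  assume "(phi_of N y m, phi_of N y n) \<in> Gamma_rel N y"
  then obtain m' n' where "m' \<in> N" "n' \<in> N" "N_of N (m' * y) \<subseteq> N_of N (n' * y)"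
    "phi_of N y m = phi_of N y m'" "phi_of N y n = phi_of N y n'"
    by (auto simp: Gamma_rel_def)
  then show "N_of N (m * y) \<subseteq> N_of N (n * y)" using phi_of_eq_iff[OF y] mn by auto
qed (use mn in \<open>auto simp: Gamma_rel_def\<close>)

lemma carrier_Gamma: "y \<noteq> 0 \<Longrightarrow> carrier (Gamma_of N y) = phi_of N y ` N"
  using normal.coset_eq[OF U_of_normal[of y]]
  by (auto simp: Gamma_of_def FactGroup_def RCOSETS_def phi_of_def)

lemma phi_of_mult:
  assumes "y \<noteq> 0" "m \<in> N" "n \<in> N"
  shows "phi_of N y m \<otimes>\<^bsub>Gamma_of N y\<^esub> phi_of N y n = phi_of N y (m * n)"
  using normal.rcos_sum[OF U_of_normal[OF assms(1)], of m n] normal.coset_eq[OF U_of_normal[OF assms(1)]] assms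
  by (simp add: Gamma_of_def FactGroup_def phi_of_def mult_in)

lemma group_Gamma: "y \<noteq> 0 \<Longrightarrow> group (Gamma_of N y)"
  unfolding Gamma_of_def by (rule normal.factorgroup_is_group[OF U_of_normal])

lemma phi_of_hom: "y \<noteq> 0 \<Longrightarrow> phi_of N y \<in> hom N_group (Gamma_of N y)"
  by (auto simp: hom_def carrier_Gamma phi_of_mult)

lemma one_Gamma: "y \<noteq> 0 \<Longrightarrow> \<one>\<^bsub>Gamma_of N y\<^esub> = phi_of N y 1"
  using group_hom.hom_one[of N_group "Gamma_of N y" "phi_of N y"] group_N group_Gamma phi_of_hom
  by (simp add: group_hom_def group_hom_axioms_def)

lemma Gamma_partial_order:
  assumes y: "y \<noteq> 0"
  shows "partial_order_on (carrier (Gamma_of N y)) (Gamma_rel N y)"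
  unfolding partial_order_on_def preorder_on_def
proof (intro conjI)
  show "Gamma_rel N y \<subseteq> carrier (Gamma_of N y) \<times> carrier (Gamma_of N y)"
    by (auto simp: carrier_Gamma[OF y] Gamma_rel_def)
  show "refl_on (carrier (Gamma_of N y)) (Gamma_rel N y)"
    by (auto simp: carrier_Gamma[OF y] phi_of_rel_iff[OF y] refl_on_def)
  show "trans (Gamma_rel N y)"
  proof (rule transI)
    fix a b c assume ab: "(a, b) \<in> Gamma_rel N y" and bc: "(b, c) \<in> Gamma_rel N y"
    obtain m n where "a = phi_of N y m" "b = phi_of N y n" "m \<in> N" "n \<in> N"
      using ab by (auto simp: Gamma_rel_def)
    moreover obtain k where "c = phi_of N y k" "k \<in> N" using bc by (auto simp: Gamma_rel_def)
    ultimately show "(a, c) \<in> Gamma_rel N y" using ab bc by (auto simp: phi_of_rel_iff[OF y])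
  qed
  show "antisym (Gamma_rel N y)"
  proof (rule antisymI)
    fix a b assume ab: "(a, b) \<in> Gamma_rel N y" and ba: "(b, a) \<in> Gamma_rel N y"
    obtain m n where "a = phi_of N y m" "b = phi_of N y n" "m \<in> N" "n \<in> N"
      using ab by (auto simp: Gamma_rel_def)
    then show "a = b" using ab ba by (auto simp: phi_of_rel_iff[OF y] phi_of_eq_iff[OF y])
  qed
qed

lemma partially_ordered_group_Gamma:
  assumes y: "y \<noteq> 0" shows "partially_ordered_group (Gamma_of N y) (Gamma_rel N y)"
proof -
  interpret G: group "Gamma_of N y" by (rule group_Gamma[OF y])
  show ?thesis
  proof
    show "partial_order_on (carrier (Gamma_of N y)) (Gamma_rel N y)"
      by (rule Gamma_partial_order[OF y])
    fix a b c assume ab: "(a, b) \<in> Gamma_rel N y" and c: "c \<in> carrier (Gamma_of N y)"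
    obtain m n where mn: "a = phi_of N y m" "b = phi_of N y n" "m \<in> N" "n \<in> N"
      using ab by (auto simp: Gamma_rel_def)
    obtain k where k: "c = phi_of N y k" "k \<in> N" using c by (auto simp: carrier_Gamma[OF y])
    show "(c \<otimes>\<^bsub>Gamma_of N y\<^esub> a, c \<otimes>\<^bsub>Gamma_of N y\<^esub> b) \<in> Gamma_rel N y"
      using ab mn k N_of_mult_left_subset_iff[of k "m * y" "n * y"]
      by (simp add: phi_of_mult[OF y] phi_of_rel_iff[OF y] mult_in mult.assoc)
    show "(a \<otimes>\<^bsub>Gamma_of N y\<^esub> c, b \<otimes>\<^bsub>Gamma_of N y\<^esub> c) \<in> Gamma_rel N y"
      using ab mn k N_of_mult_conj_subset_iff[OF y, of k m n]
      by (simp add: phi_of_mult[OF y] phi_of_rel_iff[OF y] mult_in)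
  qed
qed

lemma totally_ordered_phi_image:
  assumes y: "y \<noteq> 0" and M: "subgroup M mult_group" "M \<subseteq> N" and tot: "total_along M y"
  shows "totally_ordered_subgroup (phi_of N y ` M) (Gamma_of N y) (Gamma_rel N y)"
proof -
  have "subgroup M N_group"
    using group.subgroup_incl[OF group_mult_group M(1) subgroup M(2)] .
  then have "subgroup (phi_of N y ` M) (Gamma_of N y)"
    using group_hom.subgroup_img_is_subgroup[of N_group "Gamma_of N y" "phi_of N y" M]
      group_N group_Gamma[OF y] phi_of_hom[OF y]
    by (simp add: group_hom_def group_hom_axioms_def)
  moreover have "partial_order_on (phi_of N y ` M)
      (Gamma_rel N y \<inter> phi_of N y ` M \<times> phi_of N y ` M)"
    using Gamma_partial_order[OF y] M(2)
    unfolding partial_order_on_def preorder_on_def carrier_Gamma[OF y]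
    by (auto simp: refl_on_def antisym_def trans_def)
  moreover have "total_on (phi_of N y ` M) (Gamma_rel N y \<inter> phi_of N y ` M \<times> phi_of N y ` M)"
    using tot M(2) by (auto simp: total_on_def total_along_def phi_of_rel_iff[OF y] subset_iff)
  ultimately show ?thesis
    by (simp add: totally_ordered_subgroup_def linear_order_on_def)
qed

end

section \<open>Strong leveling and the choice of the side\<close>

lemma (in perp_relation) strongly_leveled_phi:
  assumes far: "far x y" and sym: "N_of N (- y) = N_of N y"
  shows "strongly_leveled_map N (Gamma_of N y) (Gamma_rel N y) (phi_of N y)"
proof -
  have y: "y \<noteq> 0" using far by (simp add: far_def)
  obtain \<alpha> where \<alpha>: "\<alpha> \<in> N" "N_of N y \<subseteq> N_of N (\<alpha> * y)"
    and ex: "\<exists>n\<in>N. N_of N (\<alpha> * y) \<subset> N_of N (n * y)"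
    and lev: "\<And>n. n \<in> N \<Longrightarrow> N_of N (\<alpha> * y) \<subseteq> N_of N (n * y) \<Longrightarrow>
       1 + n \<in> N \<and> N_of N ((1 + n) * y) \<subseteq> N_of N y"
    by (rule strong_level[OF far sym]) (rule that)
  have gt: "n \<in> level_gt N (Gamma_rel N y) (phi_of N y) (phi_of N y \<alpha>) \<longleftrightarrow>
      n \<in> N \<and> N_of N (\<alpha> * y) \<subset> N_of N (n * y)" for n
  proof (cases "n \<in> N")
    case True
    have "phi_of N y n = phi_of N y \<alpha> \<longleftrightarrow> N_of N (\<alpha> * y) = N_of N (n * y)"
      using phi_of_eq_iff[OF y True \<alpha>(1)] by (simp add: eq_commute)
    then show ?thesis using True \<alpha>(1) by (simp add: level_gt_def phi_of_rel_iff[OF y] psubset_eq)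
  qed (simp add: level_gt_def)
  have le: "n \<in> level_le N (Gamma_rel N y) (phi_of N y) \<one>\<^bsub>Gamma_of N y\<^esub> \<longleftrightarrow>
      n \<in> N \<and> N_of N (n * y) \<subseteq> N_of N y" for n
    using one_in by (auto simp: level_le_def one_Gamma[OF y] phi_of_rel_iff[OF y])
  note neg = N_of_uminus_mult[OF sym]
  have lev': "1 - n \<in> N \<and> N_of N ((1 - n) * y) \<subseteq> N_of N y"
    if "n \<in> N" "N_of N (\<alpha> * y) \<subseteq> N_of N (n * y)" for n
    using lev[of "- n"] that neg[OF that(1)] by (simp add: minus_in_iff)
  show ?thesis
    unfolding strongly_leveled_map_def
  proof (intro conjI bexI[of _ "phi_of N y \<alpha>"])
    show "(\<one>\<^bsub>Gamma_of N y\<^esub>, phi_of N y \<alpha>) \<in> Gamma_rel N y"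
      using \<alpha> one_in by (simp add: one_Gamma[OF y] phi_of_rel_iff[OF y])
    show "level_gt N (Gamma_rel N y) (phi_of N y) (phi_of N y \<alpha>) \<noteq> {}"
      using ex gt by blast
    show "(\<lambda>n. 1 + n) ` level_gt N (Gamma_rel N y) (phi_of N y) (phi_of N y \<alpha>)
        \<subseteq> level_le N (Gamma_rel N y) (phi_of N y) \<one>\<^bsub>Gamma_of N y\<^esub>"
      using lev by (intro image_subsetI) (simp only: gt le psubset_eq)
    show "(\<lambda>n. 1 - n) ` level_gt N (Gamma_rel N y) (phi_of N y) (phi_of N y \<alpha>)
        \<subseteq> level_le N (Gamma_rel N y) (phi_of N y) \<one>\<^bsub>Gamma_of N y\<^esub>"
      using lev' by (intro image_subsetI) (simp only: gt le psubset_eq)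
  qed (use y \<alpha> partially_ordered_group_Gamma phi_of_hom carrier_Gamma in auto)
qed

text \<open>\<open>N(y)\<close> and \<open>N(-y)\<close> are comparable because \<open>1\<close> and
  \<open>-1\<close> lie in \<open>M\<close>. Multiplication by \<open>-1\<close> interchanges them,
  so either inclusion implies the other.\<close>

lemma (in mult_normal) total_along_uminus:
  assumes "subgroup M mult_group" and "- 1 \<in> M" and "total_along M y"
  shows "N_of N (- y) = N_of N y"
proof -
  have "1 \<in> M" using subgroup.one_closed[OF assms(1)] by simp
  then have "N_of N (- y) \<subseteq> N_of N y \<or> N_of N y \<subseteq> N_of N (- y)"
    using assms(2,3) unfolding total_along_def by (metis mult_1_left mult_minus1)
  moreover have "N_of N (- a) \<subseteq> N_of N (- b)" if "N_of N a \<subseteq> N_of N b" for a b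
    using N_of_mult_left_subset_iff[OF neg_one, of a b] that by simp
  from this[of y "- y"] this[of "- y" y]
  have "N_of N y \<subseteq> N_of N (- y) \<longleftrightarrow> N_of N (- y) \<subseteq> N_of N y" by auto
  ultimately show ?thesis by blast
qed

theorem theorem7p3:
  fixes N M :: "'a::division_ring set"
    and \<Delta> :: "'a set pair_pre_digraph"
    and \<Sigma> :: "('a \<Rightarrow> 'a) set"
    and x y :: 'a
  assumes "infinite (UNIV :: 'a set)"
    and "N \<lhd> mult_group"
    and "finite (carrier (mult_group Mod N))"
    and "- 1 \<in> N"
    and "V_graph N \<Delta>"
    and "subgroup \<Sigma> (BijGroup (carrier mult_group))"
    and "\<And>\<sigma>. \<sigma> \<in> \<Sigma> \<Longrightarrow> \<sigma> ` N = N"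
    and "\<And>\<sigma> a. \<sigma> \<in> \<Sigma> \<Longrightarrow> a \<in> carrier mult_group \<Longrightarrow>
           \<sigma> ` (a <#\<^bsub>mult_group\<^esub> N) = \<sigma> a <#\<^bsub>mult_group\<^esub> N"
    and "subgroup M mult_group" and "M \<subseteq> N"
    and "x \<in> carrier mult_group - N" and "y \<in> carrier mult_group - N"
    and "property_3_half N \<Delta> x y \<Sigma> M"
  shows "(strongly_leveled_map N (Gamma_of N y) (Gamma_rel N y) (phi_of N y) \<and>
          totally_ordered_subgroup (phi_of N y ` M) (Gamma_of N y) (Gamma_rel N y)) \<or>
         (strongly_leveled_map N (Gamma_of N x) (Gamma_rel N x) (phi_of N x) \<and>
          totally_ordered_subgroup (phi_of N x ` M) (Gamma_of N x) (Gamma_rel N x))"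
proof -
  interpret half_property N \<Delta> \<Sigma> M x y
    using assms by (simp add: half_property_def half_property_axioms_def V_graph_normal_def
      V_graph_normal_axioms_def mult_normal_def star_def)
  \<comment> \<open>Kept general in \<open>a\<close> and \<open>b\<close>, so that it serves
    whichever of \<open>x\<close> and \<open>y\<close> the dichotomy selects.\<close>
  have "strongly_leveled_map N (Gamma_of N b) (Gamma_rel N b) (phi_of N b) \<and>
      totally_ordered_subgroup (phi_of N b ` M) (Gamma_of N b) (Gamma_rel N b)"
    if "total_along M b" and far: "far a b" for a b
    using strongly_leveled_phi[OF far total_along_uminus[OF M(1) neg_one_in_M]]
      totally_ordered_phi_image[OF far_nonzero(2)[OF far] M] that(1) by simp
  then show ?thesis
    using total_along_dichotomy[OF interlaced_M M] far_xy far_sym by blast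
qed

end
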